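(* Let $N>1$ be an integer and let $\mu\in\mathcal{M}_0$ have support in $\{-(N+1),\ldots,N+1\}$. Then $\mu\in\mathcal{M}_0^{UI}$ if and only if there exists a matrix of nonnegative integers $(a_n^i)_{-N\le i\le N,\,n\ge0}$ such that $$\mu(\{i\})=2^{(i\bmod2)}\sum_{j=0}^\infty4^{-j}a_j^i\quad\text{and}\quad a_n^i\le k_n^i,\qquad i\in[-N,N],\ n\ge0,$$ where $(k_n^i)_{-N\le i\le N,\,n\ge0}$ is defined from $(a^i_n)$ via $$\left\{\begin{array}{lcl}k_0^i&=&\mathbf{1}_{i=0},\\ k_{n+1}^{2i+1}&=&k_n^{2i}-a_n^{2i}+k_n^{2(i+1)}-a_n^{2(i+1)},\quad n\ge0,\ 2i+1\in[-N,N],\\ k_{n+1}^{2i}&=&k_{n+1}^{2i+1}-a_{n+1}^{2i+1}+k_{n+1}^{2i-1}-a_{n+1}^{2i-1},\quad n\ge0,\ 2i\in[-N,N],\end{array}\right.$$ with the convention $a_n^{N+1}=k_n^{N+1}$ and $a_n^{-(N+1)}=k_n^{-(N+1)}$ (so these terms contribute $0$). Furthermore, the set $\mathcal{S}^{(2N+1)}\subset[0,1]^{2N+1}$ of such measures $\mu$ is the unique fixed point of the mapping $f$ operating on the closed subsets of $[0,1]^{2N+1}$ given by $$A\mapsto\bigcup_{q\in\mathcal{W}}\Big(\tfrac14A+q\Big)\cup g(A),$$ where $\mathcal{W}$ is the compact set $$\mathcal{W}=\Big\{p\in\mathcal{S}^{(2N+1)}:\ p+\tfrac14e_0\in\mathcal{S}^{(2N+1)}\Big\}$$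 and $g(A)=\{e_0,\ \tfrac12e_{-1}+\tfrac12e_1,\ \tfrac12e_{-1}+\tfrac14e_0,\ \tfrac14e_0+\tfrac12e_1\}$, with $e_i$ the unit vector of $\mathbb{R}^{2N+1}$ (coordinates indexed by $-N,\ldots,N$) in coordinate $i$.
   Context: $(X_n)_{n\ge 0}$ is the simple symmetric random walk on $\mathbb{Z}$: $X_0=0$ and $X_n=\sum_{k=1}^n\xi_k$ with $(\xi_k)$ i.i.d., $\mathbb{P}(\xi_k=1)=\mathbb{P}(\xi_k=-1)=\frac12$. All stopping times are with respect to the natural filtration of $(X_n)$ (no external randomisation). $\mathcal{M}_0$ is the set of all centered probability measures on $\mathbb{Z}$ (finite first moment, mean zero). $\mathcal{M}_0^{UI}$ is the set of probability measures $\mu$ on $\mathbb{Z}$ for which there exists a stopping time $\tau$ such that $X_\tau\sim\mu$ and $(X_{n\wedge\tau}:n\ge 0)$ is a uniformly integrable martingale. Here $i\bmod2\in\{0,1\}$ is the parity of $i$. $\mathcal{S}^{(2N+1)}$ denotes the set of $\mu\in\mathcal{M}_0^{UI}$ with support in $[-(N+1),N+1]$, identified with the set of vectors $p=(p_{-N},\ldots,p_N)\in[0,1]^{2N+1}$, $p_i=\mu(\{i\})$ for $|i|\le N$ (such $p$ determines uniquely the centered measure $\mu$ carried by $\{-(N+1),\ldots,N+1\}$). Interpretation: $a_n^{2i}$ (resp. $a_n^{2i+1}$) is the number of paths stopped at $2i$ after $2n$ steps (resp. at $2i+1$ after $2n-1$ steps), and $k_n^{2i}$ (resp. $k_n^{2i+1}$)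 is the number of paths arriving at $2i$ after $2n$ steps (resp. at $2i+1$ after $2n-1$ steps). The set $\mathcal{W}$, defined by the formula in the claim, is introduced as the set of points of $\mathcal{S}^{(2N+1)}$ which never stop descendants of at least one of the two paths that come back to zero after 2 steps.
   Formalization: As displayed, W makes the fixed-point claim false (N=3: p=¾e₀ is in W, but ¼(½e₋₁+½e₁)+p is not in S). W is restricted to those p that also have an embedding stopping no descendant, inside [-N,N], of one of the two paths back at zero after 2 steps. *)

theory Defs
  imports "HOL-Probability.Probability"
begin

text \<open>The steps are indexed from 1; \<open>\<xi> 0\<close> is never used.\<close>

locale simple_random_walk = prob_space M
  for M :: "'a measure" and \<xi> :: "nat \<Rightarrow> 'a \<Rightarrow> int" +
  assumes indep_steps: "indep_vars (\<lambda>_. count_space UNIV) \<xi> {1..}"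
    and distr_step: "k \<ge> 1 \<Longrightarrow> distr M (count_space UNIV) (\<xi> k) = measure_pmf (pmf_of_set {-1, 1})"

definition walk :: "(nat \<Rightarrow> 'a \<Rightarrow> int) \<Rightarrow> nat \<Rightarrow> 'a \<Rightarrow> int" where
  "walk \<xi> n \<omega> = (\<Sum>k=1..n. \<xi> k \<omega>)"

text \<open>The filtration is indexed by \<^typ>\<open>enat\<close> so that the library notion \<^const>\<open>stopping_time\<close> applies
  to stopping times that may be infinite. Such stopping times cannot be avoided, even if they are
  almost surely finite: an exit time from an interval is infinite on some individual paths.\<close>

definition walk_filtration :: "'a measure \<Rightarrow> (nat \<Rightarrow> 'a \<Rightarrow> int) \<Rightarrow> enat \<Rightarrow> 'a measure" where
  "walk_filtration M \<xi> t =
     sigma (space M) {walk \<xi> m -` B \<inter> space M | m B. enat m \<le> t}"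

definition stopped_walk :: "(nat \<Rightarrow> 'a \<Rightarrow> int) \<Rightarrow> ('a \<Rightarrow> enat) \<Rightarrow> nat \<Rightarrow> 'a \<Rightarrow> real" where
  "stopped_walk \<xi> \<tau> n \<omega> = real_of_int (walk \<xi> (the_enat (min (enat n) (\<tau> \<omega>))) \<omega>)"

definition martingale :: "'a measure \<Rightarrow> (nat \<Rightarrow> 'a measure) \<Rightarrow> (nat \<Rightarrow> 'a \<Rightarrow> real) \<Rightarrow> bool" where
  "martingale M F Y \<longleftrightarrow>
     (\<forall>n. Y n \<in> borel_measurable (F n) \<and> integrable M (Y n)) \<and>
     (\<forall>m n. m \<le> n \<longrightarrow> (AE \<omega> in M. real_cond_exp M (F m) (Y n) \<omega> = Y m \<omega>))"

definition uniformly_integrable :: "'a measure \<Rightarrow> (nat \<Rightarrow> 'a \<Rightarrow> real) \<Rightarrow> bool" where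
  "uniformly_integrable M Y \<longleftrightarrow>
     (\<forall>n. integrable M (Y n)) \<and>
     (\<forall>\<epsilon>>0. \<exists>K. \<forall>n. (\<integral>\<omega>. \<bar>Y n \<omega>\<bar> * indicator {\<omega>. \<bar>Y n \<omega>\<bar> > K} \<omega> \<partial>M) \<le> \<epsilon>)"

text \<open>Probability measures on the integers are represented by the type \<^typ>\<open>int pmf\<close>. The value of
  \<^term>\<open>walk \<xi> (the_enat (\<tau> \<omega>)) \<omega>\<close> at \<open>\<tau> \<omega> = \<infinity>\<close> is irrelevant, this being a null event.\<close>

definition UI_embeds ::
    "'a measure \<Rightarrow> (nat \<Rightarrow> 'a \<Rightarrow> int) \<Rightarrow> ('a \<Rightarrow> enat) \<Rightarrow> int pmf \<Rightarrow> bool" where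
  "UI_embeds M \<xi> \<tau> \<mu> \<longleftrightarrow>
     stopping_time (walk_filtration M \<xi>) \<tau> \<and>
     (AE \<omega> in M. \<tau> \<omega> < \<infinity>) \<and>
     distr M (count_space UNIV) (\<lambda>\<omega>. walk \<xi> (the_enat (\<tau> \<omega>)) \<omega>) = measure_pmf \<mu> \<and>
     martingale M (\<lambda>n. walk_filtration M \<xi> (enat n)) (stopped_walk \<xi> \<tau>) \<and>
     uniformly_integrable M (stopped_walk \<xi> \<tau>)"

definition M0 :: "int pmf set" where
  "M0 = {\<mu>. integrable (measure_pmf \<mu>) real_of_int \<and> measure_pmf.expectation \<mu> real_of_int = 0}"

definition M0_UI :: "'a measure \<Rightarrow> (nat \<Rightarrow> 'a \<Rightarrow> int) \<Rightarrow> int pmf set" where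
  "M0_UI M \<xi> = {\<mu>. \<exists>\<tau>. UI_embeds M \<xi> \<tau> \<mu>}"

text \<open>The paths which arrive at \<open>i\<close> and go on. The case distinction is the convention
  \<open>a n i = k n i\<close> for \<open>\<bar>i\<bar> = N + 1\<close>.\<close>

definition remaining ::
    "nat \<Rightarrow> (nat \<Rightarrow> int \<Rightarrow> nat) \<Rightarrow> (nat \<Rightarrow> int \<Rightarrow> int) \<Rightarrow> nat \<Rightarrow> int \<Rightarrow> int" where
  "remaining N a k n i = (if \<bar>i\<bar> \<le> int N then k n i - int (a n i) else 0)"

text \<open>The recursion determines \<open>k n i\<close> from \<open>a\<close> for \<open>\<bar>i\<bar> \<le> N\<close>. As \<open>k\<close> is integer-valued,
  the subtraction is not truncated.\<close>

definition arrival_counts ::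
    "nat \<Rightarrow> (nat \<Rightarrow> int \<Rightarrow> nat) \<Rightarrow> (nat \<Rightarrow> int \<Rightarrow> int) \<Rightarrow> bool" where
  "arrival_counts N a k \<longleftrightarrow>
     (\<forall>i\<in>{-int N..int N}. k 0 i = (if i = 0 then 1 else 0)) \<and>
     (\<forall>n i. 2*i+1 \<in> {-int N..int N} \<longrightarrow>
        k (n+1) (2*i+1) = remaining N a k n (2*i) + remaining N a k n (2*(i+1))) \<and>
     (\<forall>n i. 2*i \<in> {-int N..int N} \<longrightarrow>
        k (n+1) (2*i) = remaining N a k (n+1) (2*i+1) + remaining N a k (n+1) (2*i-1))"

text \<open>Vectors with coordinates indexed by \<open>-N, \<dots>, N\<close> are functions \<^typ>\<open>int \<Rightarrow> real\<close> which vanish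
  outside of \<open>{-N..N}\<close>; on these the product topology of the function type is the Euclidean one.\<close>

definition unit_cube :: "nat \<Rightarrow> (int \<Rightarrow> real) set" where
  "unit_cube N = {p. (\<forall>i\<in>{-int N..int N}. p i \<in> {0..1}) \<and> (\<forall>i. i \<notin> {-int N..int N} \<longrightarrow> p i = 0)}"

definition unit_vec :: "int \<Rightarrow> int \<Rightarrow> real" where
  "unit_vec i = (\<lambda>j. if j = i then 1 else 0)"

definition coords :: "nat \<Rightarrow> int pmf \<Rightarrow> int \<Rightarrow> real" where
  "coords N \<mu> = (\<lambda>i. if i \<in> {-int N..int N} then pmf \<mu> i else 0)"

definition S_set :: "'a measure \<Rightarrow> (nat \<Rightarrow> 'a \<Rightarrow> int) \<Rightarrow> nat \<Rightarrow> (int \<Rightarrow> real) set" where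
  "S_set M \<xi> N = coords N ` {\<mu> \<in> M0_UI M \<xi>. set_pmf \<mu> \<subseteq> {-(int N + 1)..int N + 1}}"

text \<open>\<open>p\<close> is embedded in such a way that no descendant of one of the two paths which return to 0
  after two steps (first step \<open>s\<close>, second step \<open>-s\<close>) is stopped strictly inside
  \<open>{-(N+1)..N+1}\<close>. In particular this path is itself not stopped at time 0, 1 or 2.\<close>

definition spares_return_path ::
    "'a measure \<Rightarrow> (nat \<Rightarrow> 'a \<Rightarrow> int) \<Rightarrow> nat \<Rightarrow> (int \<Rightarrow> real) \<Rightarrow> bool" where
  "spares_return_path M \<xi> N p \<longleftrightarrow>
     (\<exists>\<mu> \<tau>. \<exists>s\<in>{-1, 1}. UI_embeds M \<xi> \<tau> \<mu> \<and> set_pmf \<mu> \<subseteq> {-(int N + 1)..int N + 1} \<and>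
        coords N \<mu> = p \<and>
        (AE \<omega> in M. \<xi> 1 \<omega> = s \<and> \<xi> 2 \<omega> = - s \<longrightarrow> \<bar>walk \<xi> (the_enat (\<tau> \<omega>)) \<omega>\<bar> = int N + 1))"

text \<open>The set is meant to consist of the points of \<open>S\<close> which never stop the descendants of one of
  the two paths that return to 0 after two steps. The condition \<open>p + e\<^sub>0/4 \<in> S\<close> follows from this
  but does not imply it: for \<open>N = 3\<close> the point \<open>p = (3/4) e\<^sub>0\<close> is in \<open>S\<close> (stop at the first return
  to 0 or at \<open>\<plusminus>4\<close>) and so is \<open>p + e\<^sub>0/4 = e\<^sub>0\<close> (stop at time 0), but with \<open>s = (e\<^sub>-\<^sub>1 + e\<^sub>1)/2 \<in> S\<close>
  the point \<open>s/4 + p\<close> is not in \<open>S\<close>. Both conditions are therefore imposed.\<close>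

definition W_set :: "'a measure \<Rightarrow> (nat \<Rightarrow> 'a \<Rightarrow> int) \<Rightarrow> nat \<Rightarrow> (int \<Rightarrow> real) set" where
  "W_set M \<xi> N =
     {p \<in> S_set M \<xi> N. (\<lambda>i. p i + 1/4 * unit_vec 0 i) \<in> S_set M \<xi> N \<and> spares_return_path M \<xi> N p}"

definition g_map :: "(int \<Rightarrow> real) set \<Rightarrow> (int \<Rightarrow> real) set" where
  "g_map A =
     {unit_vec 0,
      (\<lambda>i. 1/2 * unit_vec (-1) i + 1/2 * unit_vec 1 i),
      (\<lambda>i. 1/2 * unit_vec (-1) i + 1/4 * unit_vec 0 i),
      (\<lambda>i. 1/4 * unit_vec 0 i + 1/2 * unit_vec 1 i)}"

definition f_map ::
    "'a measure \<Rightarrow> (nat \<Rightarrow> 'a \<Rightarrow> int) \<Rightarrow> nat \<Rightarrow> (int \<Rightarrow> real) set \<Rightarrow> (int \<Rightarrow> real) set" where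
  "f_map M \<xi> N A = (\<Union>q\<in>W_set M \<xi> N. (\<lambda>p i. 1/4 * p i + q i) ` A) \<union> g_map A"

end

theory Submission
  imports Defs
begin

text \<open>A stopping time of the natural filtration is almost surely the first time at which the word of
  steps lies in a set \<open>D\<close> of finite words over \<open>{-1, 1}\<close>, and uniform integrability together with the
  bounded support forces it to occur before the walk can leave \<open>{-(N+1)..N+1}\<close>. So \<open>S\<close> is the image of
  all sets \<open>D\<close> under the map which counts the stopped words with weight \<open>2\<^sup>-\<^sup>n\<close>, and the mass at
  \<open>\<plusminus>(N+1)\<close> is recovered from total mass 1 and mean 0. The counting characterization follows because
  only the numbers of stopped words matter, not which words are chosen. The sets \<open>D\<close> form a compact
  product space on which the map is continuous, since the number of words that stay inside decays
  geometrically relative to \<open>2\<^sup>n\<close>; this gives closedness of \<open>S\<close> and \<open>W\<close>. Cutting out the part of \<open>D\<close>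
  below the word \<open>[s, -s]\<close>, which returns to 0, yields the self-similarity, and the fixed point is
  unique because the maps contract by \<open>1/4\<close>.\<close>

section \<open>Counting words of steps\<close>

text \<open>The sets \<open>D\<close> are left unrestricted: they need not be prefix-free, and words
  of \<open>D\<close> that are never reached do no harm, because only the first entry counts. This
  makes the parameter space a full product of copies of {0, 1}, and it allows pieces of different
  sets to be glued. The price is paid on the way back: the set read off from a stopping time also
  contains the words stopped at \<plusminus>(N+1), so a spared branch becomes an avoided one only
  after words that do not count have been discarded. That the walk cannot leave the strip rests on
  every finite word having positive probability. The stopped walk is constant on the cylinder of a
  word and equals the conditional mean of the final position there, so it obeys the bound N+1 for
  every single word. A path still running at \<plusminus>(N+1) would have a one-step extension that
  violates this bound.\<close>

definition path_words :: "nat \<Rightarrow> int list set" where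
  "path_words n = {w. set w \<subseteq> {-1, 1} \<and> length w = n}"

text \<open>Only proper prefixes are constrained, so a word may end at \<plusminus>(N+1), where the
  path is stopped regardless of \<open>D\<close>.\<close>

definition inside_words :: "nat \<Rightarrow> nat \<Rightarrow> int list set" where
  "inside_words N n = {w \<in> path_words n. \<forall>m<n. \<bar>sum_list (take m w)\<bar> \<le> int N}"

definition arriving :: "nat \<Rightarrow> int list set \<Rightarrow> nat \<Rightarrow> int \<Rightarrow> int list set" where
  "arriving N D n i = {w \<in> inside_words N n. sum_list w = i \<and> (\<forall>m<n. take m w \<notin> D)}"

definition continuing :: "nat \<Rightarrow> int list set \<Rightarrow> nat \<Rightarrow> int \<Rightarrow> int list set" where
  "continuing N D n i = (if \<bar>i\<bar> \<le> int N then arriving N D n i - D else {})"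

definition stopped :: "nat \<Rightarrow> int list set \<Rightarrow> nat \<Rightarrow> int \<Rightarrow> int list set" where
  "stopped N D n i = arriving N D n i \<inter> D"

text \<open>The mass at \<open>i\<close> when the walk stops at its first entry into
  \<open>D\<close> or on leaving the strip: each word of length \<open>n\<close> has probability
  \<open>1 / 2 ^ n\<close>. The value 0 outside the index range matches
  \<open>coords\<close>.\<close>

definition stop_vec :: "nat \<Rightarrow> int list set \<Rightarrow> int \<Rightarrow> real" where
  "stop_vec N D i =
     (if \<bar>i\<bar> \<le> int N then \<Sum>n. real (card (stopped N D n i)) / 2 ^ n else 0)"

lemma finite_path_words: "finite (path_words n)"
  unfolding path_words_def by (rule finite_lists_length_eq) simp

lemma card_path_words: "card (path_words n) = 2 ^ n"
  unfolding path_words_def using card_lists_length_eq[of "{-1,1::int}" n] by (simp add: numeral_2_eq_2)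

lemma path_words_append:
  "length u = m \<Longrightarrow> u @ v \<in> path_words (m + n) \<longleftrightarrow> u \<in> path_words m \<and> v \<in> path_words n"
  by (auto simp: path_words_def)

lemma finite_inside_words: "finite (inside_words N n)"
  unfolding inside_words_def using finite_path_words by simp

lemma finite_arriving: "finite (arriving N D n i)"
  unfolding arriving_def using finite_inside_words by simp

lemma finite_stopped: "finite (stopped N D n i)"
  unfolding stopped_def using finite_arriving by simp

lemma stopped_subset: "stopped N D n i \<subseteq> inside_words N n"
  by (auto simp: stopped_def arriving_def)

lemma card_stopped_le: "card (stopped N D n i) \<le> card (inside_words N n)"
  by (rule card_mono[OF finite_inside_words stopped_subset])

lemma arriving_0: "arriving N D 0 i = (if i = 0 then {[]} else {})"
  by (auto simp: arriving_def inside_words_def path_words_def)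

lemma take_snoc_bounded: "(\<forall>m<Suc n. P (take m (v @ [s]))) \<longleftrightarrow> (\<forall>m<n. P (take m v)) \<and> P v"
  if "length v = n"
  using that by (auto simp: less_Suc_eq)

lemma snoc_in_inside_words:
  "v @ [s] \<in> inside_words N (Suc n) \<longleftrightarrow> v \<in> inside_words N n \<and> s \<in> {-1, 1} \<and> \<bar>sum_list v\<bar> \<le> int N"
proof (cases "length v = n")
  case True
  then show ?thesis
    using take_snoc_bounded[OF True, of "\<lambda>w. \<bar>sum_list w\<bar> \<le> int N" s]
    by (auto simp: inside_words_def path_words_def)
qed (auto simp: inside_words_def path_words_def)

lemma snoc_in_arriving:
  "v @ [s] \<in> arriving N D (Suc n) i \<longleftrightarrow> s \<in> {-1, 1} \<and> v \<in> continuing N D n (i - s)"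
proof (cases "length v = n")
  case True
  then show ?thesis
    using take_snoc_bounded[OF True, of "\<lambda>w. w \<notin> D" s]
    by (auto simp: arriving_def continuing_def snoc_in_inside_words)
qed (auto simp: arriving_def continuing_def inside_words_def path_words_def)

lemma path_words_Suc: "path_words (Suc n) = (\<Union>s\<in>{-1,1}. (\<lambda>v. v @ [s]) ` path_words n)"
proof
  show "path_words (Suc n) \<subseteq> (\<Union>s\<in>{-1,1}. (\<lambda>v. v @ [s]) ` path_words n)"
  proof
    fix w assume w: "w \<in> path_words (Suc n)"
    then have "w \<noteq> []" by (auto simp: path_words_def)
    then have "w = butlast w @ [last w]" "last w \<in> set w" by simp_all
    moreover have "butlast w \<in> path_words n"
      using w by (auto simp: path_words_def dest: in_set_butlastD)
    ultimately show "w \<in> (\<Union>s\<in>{-1,1}. (\<lambda>v. v @ [s]) ` path_words n)"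
      using w by (intro UN_I[of "last w"] image_eqI[of _ _ "butlast w"]) (auto simp: path_words_def)
  qed
qed (auto simp: path_words_def)

lemma arriving_Suc:
  "arriving N D (Suc n) i = (\<lambda>v. v @ [1]) ` continuing N D n (i - 1)
     \<union> (\<lambda>v. v @ [-1]) ` continuing N D n (i + 1)"
proof
  show "arriving N D (Suc n) i \<subseteq> (\<lambda>v. v @ [1]) ` continuing N D n (i - 1)
     \<union> (\<lambda>v. v @ [-1]) ` continuing N D n (i + 1)"
  proof
    fix w assume w: "w \<in> arriving N D (Suc n) i"
    then have "w \<in> path_words (Suc n)" by (simp add: arriving_def inside_words_def)
    then obtain v s where "w = v @ [s]" by (auto simp: path_words_Suc)
    with w show "w \<in> (\<lambda>v. v @ [1]) ` continuing N D n (i - 1)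
       \<union> (\<lambda>v. v @ [-1]) ` continuing N D n (i + 1)"
      by (auto simp: snoc_in_arriving)
  qed
qed (auto simp: snoc_in_arriving)

lemma finite_continuing: "finite (continuing N D n i)"
  by (simp add: continuing_def finite_arriving)

lemma card_arriving_Suc:
  "card (arriving N D (Suc n) i) = card (continuing N D n (i - 1)) + card (continuing N D n (i + 1))"
  unfolding arriving_Suc
  by (subst card_Un_disjoint) (auto simp: finite_continuing card_image inj_on_def)

lemma card_continuing:
  "\<bar>i\<bar> \<le> int N \<Longrightarrow> int (card (continuing N D n i)) = int (card (arriving N D n i)) - int (card (stopped N D n i))"
  unfolding continuing_def stopped_def
  using card_Diff_subset_Int[of "arriving N D n i" D] card_mono[of "arriving N D n i" "arriving N D n i \<inter> D"] finite_arriving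
  by (simp add: of_nat_diff)

lemma arriving_parity:
  assumes "w \<in> path_words n" shows "even (sum_list w + int n)"
proof -
  have "set w \<subseteq> {-1,1} \<Longrightarrow> even (sum_list w + int (length w))" for w :: "int list"
    by (induction w) auto
  with assms show ?thesis by (auto simp: path_words_def)
qed

lemma arriving_empty: "odd (i + int n) \<Longrightarrow> arriving N D n i = {}"
  using arriving_parity by (auto simp: arriving_def inside_words_def)

section \<open>Geometric decay of the number of inside words\<close>

text \<open>An up-step run of length \<open>2N + 2\<close> leaves the strip from every interior point, so each
  block of this length loses a fixed fraction of the words.\<close>

lemma card_inside_words_block:
  assumes L: "L = 2 * N + 2"
  shows "card (inside_words N (n + L)) \<le> card (inside_words N n) * (2 ^ L - 1)"
proof -
  have "inside_words N (n + L)
      \<subseteq> (\<lambda>(v, u). v @ u) ` (inside_words N n \<times> (path_words L - {replicate L 1}))"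
  proof
    fix w assume w: "w \<in> inside_words N (n + L)"
    define v where "v = take n w"
    define u where "u = drop n w"
    have wvu: "w = v @ u" and len: "length w = n + L" "length v = n" "length u = L"
      using w by (auto simp: v_def u_def inside_words_def path_words_def)
    have "w \<in> path_words (n + L)" using w by (simp add: inside_words_def)
    then have pv: "v \<in> path_words n" and pu: "u \<in> path_words L"
      using wvu len path_words_append by auto
    have b: "\<bar>sum_list (take m w)\<bar> \<le> int N" if "m < n + L" for m
      using w that by (auto simp: inside_words_def)
    have "\<bar>sum_list (take m v)\<bar> \<le> int N" if "m < n" for m
      using b[of m] that by (simp add: v_def min_def)
    then have "v \<in> inside_words N n" using pv by (simp add: inside_words_def)
    moreover have "u \<noteq> replicate L 1"
    proof
      assume u: "u = replicate L 1"
      have "\<bar>sum_list v\<bar> \<le> int N" using b[of n] wvu len L by simp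
      \<comment> \<open>\<open>inside_words\<close> does not bound the sum of the full word, so the
        run is examined after L - 1 = 2N + 1 steps; from a site at or above -N these lead to N + 1
        or beyond.\<close>
      moreover have "\<bar>sum_list (take (n + (L - 1)) w)\<bar> \<le> int N" using b[of "n + (L - 1)"] L by simp
      moreover have "sum_list (take (n + (L - 1)) w) = sum_list v + int (L - 1)"
        using u len wvu by (simp add: sum_list_replicate)
      ultimately show False using L by simp
    qed
    ultimately show "w \<in> (\<lambda>(v, u). v @ u) ` (inside_words N n \<times> (path_words L - {replicate L 1}))"
      using pu wvu by auto
  qed
  then have "card (inside_words N (n + L))
      \<le> card ((\<lambda>(v, u). v @ u) ` (inside_words N n \<times> (path_words L - {replicate L (1::int)})))"
    by (intro card_mono finite_imageI finite_cartesian_product finite_inside_words finite_Diff finite_path_words)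
  also have "\<dots> \<le> card (inside_words N n \<times> (path_words L - {replicate L (1::int)}))"
    by (intro card_image_le finite_cartesian_product finite_inside_words finite_Diff finite_path_words)
  also have "\<dots> = card (inside_words N n) * (2 ^ L - 1)"
  proof -
    have "replicate L 1 \<in> path_words L" by (auto simp: path_words_def)
    then show ?thesis by (simp add: card_cartesian_product finite_path_words card_path_words)
  qed
  finally show ?thesis .
qed

text \<open>Iterating the block estimate gives \<open>r (k * L + j) \<le> C * \<theta> ^ k\<close>;
  grouping the indices into blocks of length \<open>L\<close> bounds all partial sums by
  \<open>L\<close> times a geometric series.\<close>

lemma summable_block_contraction:
  fixes r :: "nat \<Rightarrow> real"
  assumes "\<And>n. 0 \<le> r n" "\<And>n. r n \<le> C" "L > 0" "0 \<le> \<theta>" "\<theta> < 1"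
    and blk: "\<And>n. r (n + L) \<le> \<theta> * r n"
  shows "summable r"
proof (rule bounded_imp_summable[where B = "real L * C / (1 - \<theta>)"])
  have C: "C \<ge> 0" using assms(1,2)[of 0] by linarith
  have rn: "r (k * L + j) \<le> C * \<theta> ^ k" for k j
  proof (induction k)
    case (Suc k)
    have "r (Suc k * L + j) \<le> \<theta> * r (k * L + j)"
      using blk[of "k * L + j"] by (simp add: algebra_simps)
    also have "\<dots> \<le> \<theta> * (C * \<theta> ^ k)" using Suc assms(4) by (intro mult_left_mono)
    finally show ?case by (simp add: algebra_simps)
  qed (use assms in simp)
  show "sum r {..n} \<le> real L * C / (1 - \<theta>)" for n
  proof -
    have "Suc n * 1 \<le> Suc n * L" using assms(3) by (intro mult_le_mono) simp_all
    then have "n < Suc n * L" by simp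
    then have "{..n} \<subseteq> {..<Suc n * L}" by (auto simp del: mult_Suc)
    then have "sum r {..n} \<le> sum r {..<Suc n * L}"
      using assms(1) by (intro sum_mono2) (auto simp del: mult_Suc)
    also have "\<dots> = (\<Sum>k<Suc n. \<Sum>i\<in>{k * L..<k * L + L}. r i)"
      by (rule sum.nat_group[symmetric])
    also have "\<dots> \<le> (\<Sum>k<Suc n. real L * (C * \<theta> ^ k))"
    proof (rule sum_mono)
      fix k
      have "(\<Sum>i\<in>{k * L..<k * L + L}. r i) \<le> (\<Sum>i\<in>{k * L..<k * L + L}. C * \<theta> ^ k)"
      proof (rule sum_mono)
        fix i assume "i \<in> {k * L..<k * L + L}"
        then show "r i \<le> C * \<theta> ^ k" using rn[of k "i - k * L"] by simp
      qed
      then show "(\<Sum>i\<in>{k * L..<k * L + L}. r i) \<le> real L * (C * \<theta> ^ k)" by simp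
    qed
    also have "\<dots> = real L * C * (\<Sum>k<Suc n. \<theta> ^ k)"
      by (simp add: sum_distrib_left algebra_simps)
    also have "\<dots> \<le> real L * C * (1 / (1 - \<theta>))"
      using C assms(4,5) sum_le_suminf[OF summable_geometric, of \<theta> "{..<Suc n}"]
      by (intro mult_left_mono) (simp_all add: suminf_geometric)
    finally show ?thesis by simp
  qed
qed (use assms in auto)

text \<open>The common majorant of all series over stopped words, independent of \<open>D\<close>
  and of the site. The contraction factor is the fraction left when one of the 2^L continuations of
  a block is forbidden.\<close>

lemma summable_card_inside_words: "summable (\<lambda>n. real (card (inside_words N n)) / 2 ^ n)"
proof (rule summable_block_contraction[where C = 1 and L = "2 * N + 2" and \<theta> = "1 - 1 / 2 ^ (2 * N + 2)"])
  show "real (card (inside_words N n)) / 2 ^ n \<le> 1" for n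
  proof -
    have "card (inside_words N n) \<le> card (path_words n)"
      by (intro card_mono finite_path_words) (auto simp: inside_words_def)
    then have "real (card (inside_words N n)) \<le> 2 ^ n"
      unfolding card_path_words by (metis of_nat_le_iff of_nat_numeral of_nat_power)
    then show ?thesis by simp
  qed
  show "real (card (inside_words N (n + (2 * N + 2)))) / 2 ^ (n + (2 * N + 2))
      \<le> (1 - 1 / 2 ^ (2 * N + 2)) * (real (card (inside_words N n)) / 2 ^ n)" for n
  proof -
    define L where "L = 2 * N + 2"
    have "real (card (inside_words N (n + L))) \<le> real (card (inside_words N n) * (2 ^ L - 1))"
      using card_inside_words_block[OF L_def] of_nat_le_iff by blast
    also have "\<dots> = real (card (inside_words N n)) * (2 ^ L - 1)"
      by (simp add: of_nat_diff)
    finally have "real (card (inside_words N (n + L))) / 2 ^ (n + L)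
        \<le> real (card (inside_words N n)) * (2 ^ L - 1) / 2 ^ (n + L)"
      by (rule divide_right_mono) simp
    also have "\<dots> = (1 - 1 / 2 ^ L) * (real (card (inside_words N n)) / 2 ^ n)"
      by (simp add: power_add field_simps)
    finally show ?thesis unfolding L_def .
  qed
  show "(0::real) \<le> 1 - 1 / 2 ^ (2 * N + 2)"
    using one_le_power[of "2::real" "2 * N + 2"] by (simp add: field_simps del: power_Suc one_le_power)
qed auto

lemma stopped_sums:
  "\<bar>i\<bar> \<le> int N \<Longrightarrow> (\<lambda>n. real (card (stopped N D n i)) / 2 ^ n) sums stop_vec N D i"
  unfolding stop_vec_def
  by simp (intro summable_sums summable_comparison_test'[OF summable_card_inside_words, of 0 _ N],
      simp add: card_stopped_le divide_right_mono)

section \<open>Compactness and the branch below a return to zero\<close>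

text \<open>Writes the number of stopped words as a polynomial in finitely many coordinates
  \<open>x w\<close>, which makes its continuity visible: the factor \<open>x w\<close> says that
  \<open>w\<close> is in the set, the product that no proper prefix is.\<close>

lemma sum_stop_indicators:
  fixes x :: "int list \<Rightarrow> real"
  assumes "\<And>w. x w \<in> {0, 1}"
  shows "(\<Sum>w\<in>{w \<in> inside_words N n. sum_list w = i}. x w * (\<Prod>m<n. 1 - x (take m w)))
    = real (card (stopped N {w. x w = 1} n i))"
proof -
  have "x w * (\<Prod>m<n. 1 - x (take m w))
      = (if x w = 1 \<and> (\<forall>m<n. x (take m w) \<noteq> 1) then 1 else 0)" for w
  proof (cases "\<exists>m<n. x (take m w) = 1")
    case True
    then have "(\<Prod>m<n. 1 - x (take m w)) = 0" by (intro prod_zero) auto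
    with True show ?thesis by auto
  next
    case False
    then have "x (take m w) = 0" if "m < n" for m
      using assms[of "take m w"] that by auto
    then have "(\<Prod>m<n. 1 - x (take m w)) = 1" by simp
    with False show ?thesis using assms[of w] by auto
  qed
  moreover have "{w \<in> inside_words N n. sum_list w = i}
      \<inter> {w. x w = 1 \<and> (\<forall>m<n. x (take m w) \<noteq> 1)} = stopped N {w. x w = 1} n i"
    by (auto simp: stopped_def arriving_def)
  ultimately show ?thesis
    by (simp add: sum.If_cases finite_inside_words)
qed

text \<open>Encoding the sets of words as points of the compact space of all functions from words to
  \<open>{0, 1}\<close>, the vector depends continuously on the set: each summand depends on finitely many
  words, and the summands are dominated by a summable sequence.\<close>

lemma compact_stop_vec_image: "compact (stop_vec N ` {D. D \<inter> X = {}})"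
proof -
  \<comment> \<open>The coordinates in \<open>X\<close> are frozen at 0, so \<open>K\<close> is a
    product of finite sets and encodes exactly the \<open>D\<close> disjoint from
    \<open>X\<close>.\<close>
  define K :: "(int list \<Rightarrow> real) set" where "K = (\<Pi>\<^sub>E w\<in>UNIV. if w \<in> X then {0} else {0, 1})"
  define F where "F i x n = (\<Sum>w\<in>{w \<in> inside_words N n. sum_list w = i}.
      x w * (\<Prod>m<n. 1 - x (take m w))) / 2 ^ n" for i n and x :: "int list \<Rightarrow> real"
  define G where "G x i = (if \<bar>i\<bar> \<le> int N then \<Sum>n. F i x n else 0)" for x i
  have "compactin (product_topology (\<lambda>_. euclidean) UNIV) K"
    unfolding K_def by (subst compactin_PiE) auto
  then have K: "compact K" by (simp add: euclidean_product_topology)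
  have K01: "x w \<in> {0, 1}" "w \<in> X \<Longrightarrow> x w = 0" if "x \<in> K" for x w
    using that by (auto simp: K_def PiE_def Pi_def split: if_splits)
  have F_eq: "F i x n = real (card (stopped N {w. x w = 1} n i)) / 2 ^ n" if "x \<in> K" for i x n
    unfolding F_def using sum_stop_indicators[of x] K01[OF that] by simp
  have "continuous_on K (\<lambda>x. \<Sum>n. F i x n)" for i
  proof (rule uniform_limit_theorem)
    show "uniform_limit K (\<lambda>m x. \<Sum>n<m. F i x n) (\<lambda>x. \<Sum>n. F i x n) sequentially"
      by (rule Weierstrass_m_test[OF _ summable_card_inside_words[of N]])
        (simp add: F_eq card_stopped_le divide_right_mono)
    show "\<forall>\<^sub>F m in sequentially. continuous_on K (\<lambda>x. \<Sum>n<m. F i x n)"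
      unfolding F_def
      by (intro always_eventually allI continuous_intros
          continuous_on_subset[OF continuous_on_product_coordinates]) auto
  qed simp
  then have "continuous_on K (\<lambda>x. G x i)" for i
    by (cases "\<bar>i\<bar> \<le> int N") (simp_all add: G_def)
  then have "continuous_on K G" by (rule continuous_on_coordinatewise_then_product)
  then have "compact (G ` K)" using K by (rule compact_continuous_image)
  moreover have "G ` K = stop_vec N ` {D. D \<inter> X = {}}"
  proof -
    have G_eq: "G x = stop_vec N {w. x w = 1}" if "x \<in> K" for x
      by (rule ext) (simp add: G_def stop_vec_def F_eq[OF that] cong: suminf_cong)
    show ?thesis
    proof (intro equalityI subsetI)
      fix y assume "y \<in> G ` K"
      then obtain x where x: "x \<in> K" "y = stop_vec N {w. x w = 1}" using G_eq by auto
      moreover have "{w. x w = 1} \<inter> X = {}" using K01(2)[OF x(1)] by auto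
      ultimately show "y \<in> stop_vec N ` {D. D \<inter> X = {}}" by auto
    next
      fix y assume "y \<in> stop_vec N ` {D. D \<inter> X = {}}"
      then obtain D where D: "D \<inter> X = {}" "y = stop_vec N D" by auto
      have "indicator D \<in> K" using D(1) by (auto simp: K_def indicator_def)
      moreover have "{w. indicator D w = (1::real)} = D" by (auto simp: indicator_def)
      ultimately show "y \<in> G ` K"
        using D(2) G_eq[of "indicator D"] by (intro image_eqI[of _ _ "indicator D"]) simp_all
    qed
  qed
  ultimately show ?thesis by simp
qed

text \<open>The words comparable with \<open>[s, -s]\<close> in the prefix order. The short words
  \<open>[]\<close> and \<open>[s]\<close> belong to it because stopping there would also stop the
  returning path.\<close>

definition return_branch :: "int \<Rightarrow> int list set" where
  "return_branch s = {w. take 2 w = take (length w) [s, -s]}"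

lemma take_2_eq: "take 2 w = [a, b] \<longleftrightarrow> (\<exists>u. w = a # b # u)"
  by (cases w rule: list.exhaust; cases "tl w" rule: list.exhaust) (auto simp: numeral_2_eq_2)

lemma return_branch_cases:
  "w \<in> return_branch s \<longleftrightarrow> w = [] \<or> w = [s] \<or> (\<exists>u. w = s # -s # u)"
  unfolding return_branch_def
  by (cases w rule: list.exhaust; cases "tl w" rule: list.exhaust) (auto simp: numeral_2_eq_2)

text \<open>The two extra steps start at 0 and pass through \<open>s\<close>, both inside the strip
  since \<open>N \<ge> 1\<close>, and end at 0, so the rest of the path sees the same
  boundaries.\<close>

lemma inside_words_return:
  assumes "s \<in> {-1, 1}" "N \<ge> 1"
  shows "s # -s # u \<in> inside_words N (Suc (Suc n)) \<longleftrightarrow> u \<in> inside_words N n"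
  using assms by (auto simp: inside_words_def path_words_def All_less_Suc2)

text \<open>If a word does not begin with \<open>[s, -s]\<close>, no prefix of it does, so the
  branch is irrelevant to it. Otherwise stripping the two letters leaves a word stopped for the
  shifted set. With \<open>[]\<close> or \<open>[s]\<close> in \<open>D\<close> the whole branch
  would be cut off instead.\<close>

lemma stopped_return:
  assumes s: "s \<in> {-1, 1}" "N \<ge> 1" and D: "[] \<notin> D" "[s] \<notin> D"
  shows "stopped N D n i = stopped N {w \<in> D. take 2 w \<noteq> [s, -s]} n i
    \<union> (if n \<ge> 2 then (\<lambda>u. s # -s # u) ` stopped N {u. s # -s # u \<in> D} (n - 2) i else {})"
    (is "?L = ?A \<union> ?B")
proof -
  have 1: "w \<in> ?L \<longleftrightarrow> w \<in> ?A" if "take 2 w \<noteq> [s, -s]" for w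
  proof -
    have "take 2 (take m w) \<noteq> [s, -s]" for m
    proof
      assume a: "take 2 (take m w) = [s, -s]"
      then have "length (take 2 (take m w)) = 2" by simp
      then have "m \<ge> 2" by simp
      then have "take 2 (take m w) = take 2 w" by (simp add: min_def)
      with a that show False by simp
    qed
    then show ?thesis using that by (auto simp: stopped_def arriving_def)
  qed
  have 2: "take 2 w \<noteq> [s, -s]" if "w \<in> ?A" for w using that by (simp add: stopped_def)
  have 3: "take 2 w = [s, -s]" if "w \<in> ?B" for w using that by (auto split: if_splits)
  have 4: "w \<in> ?L \<longleftrightarrow> w \<in> ?B" if "take 2 w = [s, -s]" for w
  proof -
    from that obtain u where w: "w = s # -s # u" by (auto simp: take_2_eq)
    show ?thesis
    proof (cases "n \<ge> 2")
      case True
      then obtain k where n: "n = Suc (Suc k)" by (metis numeral_2_eq_2 le_Suc_ex add_Suc add_0)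
      have "w \<in> ?L \<longleftrightarrow> u \<in> stopped N {u. s # -s # u \<in> D} k i"
        using D by (auto simp: stopped_def arriving_def n w inside_words_return[OF s] All_less_Suc2)
      then show ?thesis using w n by auto
    next
      case False
      then show ?thesis using w by (auto simp: stopped_def arriving_def inside_words_def path_words_def)
    qed
  qed
  show ?thesis using 1 2 3 4 by blast
qed

text \<open>The factor 1/4 is the probability of the two steps \<open>s\<close>, \<open>-s\<close>;
  in the series it appears as an index shift by 2.\<close>

lemma stop_vec_return:
  assumes s: "s \<in> {-1, 1}" "N \<ge> 1" and D: "[] \<notin> D" "[s] \<notin> D"
  shows "stop_vec N D i = stop_vec N {w \<in> D. take 2 w \<noteq> [s, -s]} i
    + 1/4 * stop_vec N {u. s # -s # u \<in> D} i"
proof (cases "\<bar>i\<bar> \<le> int N")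
  case True
  define D1 where "D1 = {w \<in> D. take 2 w \<noteq> [s, -s]}"
  define D2 where "D2 = {u. s # -s # u \<in> D}"
  have c: "card (stopped N D n i) = card (stopped N D1 n i) + (if n \<ge> 2 then card (stopped N D2 (n - 2) i) else 0)" for n
    unfolding stopped_return[OF assms, of n i, folded D1_def D2_def]
    by (subst card_Un_disjoint)
      (auto simp: finite_stopped card_image inj_on_def, auto simp: stopped_def D1_def)
  have "(\<lambda>n. 1/4 * (real (card (stopped N D2 n i)) / 2 ^ n)) sums (1/4 * stop_vec N D2 i)"
    by (intro sums_mult stopped_sums True)
  then have "(\<lambda>n. if n + 2 \<ge> 2 then real (card (stopped N D2 (n + 2 - 2) i)) / 2 ^ (n + 2) else 0)
      sums (1/4 * stop_vec N D2 i)"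
    by (simp add: field_simps)
  then have "(\<lambda>n. if n \<ge> 2 then real (card (stopped N D2 (n - 2) i)) / 2 ^ n else 0)
      sums (1/4 * stop_vec N D2 i + (\<Sum>n<2. if n \<ge> 2 then real (card (stopped N D2 (n - 2) i)) / 2 ^ n else 0))"
    by (rule sums_iff_shift[THEN iffD1])
  then have "(\<lambda>n. if n \<ge> 2 then real (card (stopped N D2 (n - 2) i)) / 2 ^ n else 0)
      sums (1/4 * stop_vec N D2 i)" by simp
  moreover have "(\<lambda>n. real (card (stopped N D n i)) / 2 ^ n) = (\<lambda>n. real (card (stopped N D1 n i)) / 2 ^ n
      + (if n \<ge> 2 then real (card (stopped N D2 (n - 2) i)) / 2 ^ n else 0))"
    by (rule ext) (simp add: c add_divide_distrib)
  ultimately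
  have "(\<lambda>n. real (card (stopped N D n i)) / 2 ^ n) sums (stop_vec N D1 i + 1/4 * stop_vec N D2 i)"
    using sums_add[OF stopped_sums[OF True, of D1]] by simp
  from sums_unique2[OF stopped_sums[OF True, of D] this] show ?thesis
    by (simp only: D1_def D2_def)
next
  case False
  then show ?thesis by (simp only: stop_vec_def if_False)
qed

lemma stop_vec_single_time:
  assumes "\<And>n i. n \<noteq> k \<Longrightarrow> stopped N D n i = {}" "\<bar>i\<bar> \<le> int N"
  shows "stop_vec N D i = real (card (stopped N D k i)) / 2 ^ k"
proof -
  have "(\<lambda>n. real (card (stopped N D n i)) / 2 ^ n)
      = (\<lambda>n. if n = k then real (card (stopped N D n i)) / 2 ^ n else 0)"
    using assms(1) by (intro ext) simp
  then have "(\<lambda>n. real (card (stopped N D n i)) / 2 ^ n) sums (real (card (stopped N D k i)) / 2 ^ k)"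
    using sums_single[of k "\<lambda>n. real (card (stopped N D n i)) / 2 ^ n"] by simp
  from sums_unique2[OF stopped_sums[OF assms(2), of D] this] show ?thesis .
qed

lemma stop_vec_time_0:
  assumes "[] \<in> D" shows "stop_vec N D = unit_vec 0"
proof
  fix i
  have "stopped N D n j = {}" if "n \<noteq> 0" for n j
  proof (rule equals0I)
    fix w assume "w \<in> stopped N D n j"
    then have "\<forall>m<n. take m w \<notin> D" by (simp add: stopped_def arriving_def)
    then have "take 0 w \<notin> D" using that by blast
    with assms show False by simp
  qed
  moreover have "stopped N D 0 i = (if i = 0 then {[]} else {})"
    using assms by (auto simp: stopped_def arriving_0)
  ultimately show "stop_vec N D i = unit_vec 0 i"
    using stop_vec_single_time[of 0 N D i] by (cases "\<bar>i\<bar> \<le> int N") (auto simp: unit_vec_def stop_vec_def)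
qed

text \<open>Under the third hypothesis no longer word is stopped: either both one-step words are in
  \<open>D\<close>, or \<open>D\<close> has only words of length one. This serves both two-sided
  stopping at time 1 and the one-sided set \<open>{[-s]}\<close>.\<close>

lemma stop_vec_time_1:
  assumes "N \<ge> 1" "[] \<notin> D" "\<And>w. w \<in> D \<Longrightarrow> length w \<noteq> 1 \<Longrightarrow> [1] \<in> D \<and> [-1] \<in> D"
  shows "stop_vec N D i = (if i \<in> {-1, 1} \<and> [i] \<in> D then 1/2 else 0)"
proof -
  have "stopped N D n j = {}" if n: "n \<noteq> 1" for n j
  proof (rule equals0I)
    fix w assume w: "w \<in> stopped N D n j"
    then have wD: "w \<in> D" and pw: "w \<in> path_words n" and tk: "\<And>m. m < n \<Longrightarrow> take m w \<notin> D"
      by (auto simp: stopped_def arriving_def inside_words_def)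
    then obtain s v where sv: "w = s # v" "s \<in> {-1, 1}" using assms(2)
      by (cases w) (auto simp: path_words_def)
    have "n > 1" using n pw sv by (auto simp: path_words_def)
    then have "[s] \<notin> D" using tk[of 1] sv by simp
    then show False using assms(3)[OF wD] n pw sv by (auto simp: path_words_def)
  qed
  moreover have "stopped N D 1 i = (if i \<in> {-1, 1} \<and> [i] \<in> D then {[i]} else {})"
  proof (rule set_eqI)
    fix w
    show "w \<in> stopped N D 1 i \<longleftrightarrow> w \<in> (if i \<in> {-1, 1} \<and> [i] \<in> D then {[i]} else {})"
    proof (cases "\<exists>s. w = [s]")
      case True
      then obtain s where "w = [s]" ..
      then show ?thesis
        using assms(2) by (auto simp: stopped_def arriving_def inside_words_def path_words_def)
    next
      case False
      then have "length w \<noteq> 1" by (auto simp: length_Suc_conv)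
      then show ?thesis by (auto simp: stopped_def arriving_def inside_words_def path_words_def)
    qed
  qed
  ultimately show ?thesis
    using stop_vec_single_time[of 1 N D i] assms(1) by (cases "\<bar>i\<bar> \<le> int N") (auto simp: stop_vec_def)
qed

section \<open>Self-similarity\<close>

text \<open>Deleting words could in principle unmask later ones. It does not: if a word stopped for
  \<open>D - X\<close> had a proper prefix in \<open>D\<close>, the shortest such prefix would be
  stopped for \<open>D\<close> at an interior site, hence lie outside \<open>X\<close>, and would
  already stop the path for \<open>D - X\<close>.\<close>

lemma stop_vec_diff:
  assumes "\<And>n i. \<bar>i\<bar> \<le> int N \<Longrightarrow> stopped N D n i \<inter> X = {}"
  shows "stop_vec N (D - X) = stop_vec N D"
proof
  fix i
  have "stopped N (D - X) n i = stopped N D n i" if i: "\<bar>i\<bar> \<le> int N" for n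
  proof
    show "stopped N D n i \<subseteq> stopped N (D - X) n i"
      using assms[OF i, of n] by (auto simp: stopped_def arriving_def)
    show "stopped N (D - X) n i \<subseteq> stopped N D n i"
    proof
      fix w assume w: "w \<in> stopped N (D - X) n i"
      have "take m w \<notin> D" if "m < n" for m
        using that
      proof (induction m rule: less_induct)
        case (less m)
        have win: "w \<in> inside_words N n" using w by (auto simp: stopped_def arriving_def)
        show ?case
        proof
          assume a: "take m w \<in> D"
          have b: "\<bar>sum_list (take m w)\<bar> \<le> int N" using win less.prems by (auto simp: inside_words_def)
          have tt: "take l (take m w) = take l w" if "l < m" for l using that by (simp add: min_def)
          have "take m w \<in> inside_words N m"
            using win less.prems tt
            by (auto simp: inside_words_def path_words_def dest: in_set_takeD)
          then have "take m w \<in> stopped N D m (sum_list (take m w))"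
            using a tt less by (auto simp: stopped_def arriving_def)
          then have "take m w \<notin> X" using assms[OF b, of m] by auto
          with a w less.prems show False by (auto simp: stopped_def arriving_def)
        qed
      qed
      then show "w \<in> stopped N D n i" using w by (auto simp: stopped_def arriving_def)
    qed
  qed
  then show "stop_vec N (D - X) i = stop_vec N D i" by (simp add: stop_vec_def)
qed

text \<open>The description of \<open>W\<close> by sets of words; the two are identified in
  \<open>W_set_eq\<close>.\<close>

definition sparing_vecs :: "nat \<Rightarrow> (int \<Rightarrow> real) set" where
  "sparing_vecs N = (\<Union>s\<in>{-1, 1}. stop_vec N ` {D. D \<inter> return_branch s = {}})"

lemma compact_range_stop_vec: "compact (range (stop_vec N))"
  using compact_stop_vec_image[of N "{}"] by simp

lemma compact_sparing_vecs: "compact (sparing_vecs N)"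
  unfolding sparing_vecs_def by (intro compact_UN compact_stop_vec_image) simp

text \<open>A copy of \<open>D2\<close> is grafted below \<open>[s, -s]\<close>. There is no
  conflict, since \<open>D1\<close> contains no word comparable with \<open>[s, -s]\<close>, and
  \<open>stop_vec_return\<close> splits the union into the two summands again.\<close>

lemma sparing_vecs_add:
  assumes "N \<ge> 1" "q \<in> sparing_vecs N" "p \<in> range (stop_vec N)"
  shows "(\<lambda>i. 1/4 * p i + q i) \<in> range (stop_vec N)"
proof -
  obtain s D1 D2 where s: "s \<in> {-1, 1}" and D: "D1 \<inter> return_branch s = {}"
    "q = stop_vec N D1" "p = stop_vec N D2"
    using assms by (auto simp: sparing_vecs_def)
  define E where "E = D1 \<union> (\<lambda>u. s # -s # u) ` D2"
  have "[] \<notin> E" "[s] \<notin> E" using D(1) by (auto simp: E_def return_branch_cases)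
  moreover have "take 2 w \<noteq> [s, -s]" if "w \<in> D1" for w
  proof
    assume "take 2 w = [s, -s]"
    then have "w \<in> return_branch s"
      by (auto simp: take_2_eq return_branch_cases)
    then show False using D(1) that by auto
  qed
  then have "{w \<in> E. take 2 w \<noteq> [s, -s]} = D1" by (auto simp: E_def)
  moreover have "{u. s # -s # u \<in> E} = D2"
    using D(1) by (auto simp: E_def return_branch_cases)
  ultimately have "stop_vec N E i = 1/4 * p i + q i" for i
    using stop_vec_return[of s N E i] s assms(1) D by simp
  then show ?thesis by (intro image_eqI[of _ _ E]) auto
qed

lemma unit_vec_0_in_range: "unit_vec 0 \<in> range (stop_vec N)"
  using stop_vec_time_0[of "{[]}" N] by (metis rangeI singletonI)

text \<open>Either the walk stops at time 0, or both one-step words are stopped, or some first step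
  \<open>s\<close> goes on; in the last case the branch below \<open>[s, -s]\<close> can be cut
  out.\<close>

lemma range_stop_vec_self_similar:
  assumes "N \<ge> 1"
  shows "range (stop_vec N)
    = (\<Union>q\<in>sparing_vecs N. (\<lambda>p i. 1/4 * p i + q i) ` range (stop_vec N)) \<union> g_map A"
proof (intro equalityI subsetI)
  fix p assume "p \<in> range (stop_vec N)"
  then obtain D where D: "p = stop_vec N D" by auto
  consider "[] \<in> D" | "[] \<notin> D" "[1] \<in> D" "[-1] \<in> D"
    | s where "s \<in> {-1, 1}" "[] \<notin> D" "[s] \<notin> D" by blast
  then show "p \<in> (\<Union>q\<in>sparing_vecs N. (\<lambda>p i. 1/4 * p i + q i) ` range (stop_vec N)) \<union> g_map A"
  proof cases
    case 1
    then show ?thesis using stop_vec_time_0 D by (simp add: g_map_def)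
  next
    case 2
    then have "p = (\<lambda>i. 1/2 * unit_vec (-1) i + 1/2 * unit_vec 1 i)"
      using stop_vec_time_1[of N D] assms by (auto simp: D unit_vec_def)
    then show ?thesis by (simp add: g_map_def)
  next
    case (3 s)
    let ?D1 = "{w \<in> D. take 2 w \<noteq> [s, -s]}"
    have "?D1 \<inter> return_branch s = {}" using 3 by (auto simp: return_branch_cases)
    then have "stop_vec N ?D1 \<in> sparing_vecs N" using 3(1) unfolding sparing_vecs_def by blast
    moreover have "p = (\<lambda>i. 1/4 * stop_vec N {u. s # -s # u \<in> D} i + stop_vec N ?D1 i)"
      using stop_vec_return[of s N D] 3 assms by (auto simp: D)
    ultimately show ?thesis by blast
  qed
next
  \<comment> \<open>The one-sided points of \<open>g_map\<close> arise by grafting: stop after a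
    first step \<open>-s\<close>, and otherwise at the return to 0 after two steps.\<close>
  have one_sided: "(\<lambda>i. 1/2 * unit_vec (-s) i + 1/4 * unit_vec 0 i) \<in> range (stop_vec N)"
    if s: "s \<in> {-1, 1}" for s
  proof -
    have "{[-s]} \<inter> return_branch s = {}" using s by (auto simp: return_branch_cases)
    then have "stop_vec N {[-s]} \<in> sparing_vecs N" using s unfolding sparing_vecs_def by blast
    note sparing_vecs_add[OF assms this unit_vec_0_in_range]
    moreover have "stop_vec N {[-s]} = (\<lambda>i. 1/2 * unit_vec (-s) i)"
      using stop_vec_time_1[of N "{[-s]}"] assms s by (auto simp: unit_vec_def)
    ultimately show ?thesis by (simp add: add.commute)
  qed
  fix p assume "p \<in> (\<Union>q\<in>sparing_vecs N. (\<lambda>p i. 1/4 * p i + q i) ` range (stop_vec N)) \<union> g_map A"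
  then consider "p \<in> (\<Union>q\<in>sparing_vecs N. (\<lambda>p i. 1/4 * p i + q i) ` range (stop_vec N))"
    | "p = unit_vec 0" | "p = (\<lambda>i. 1/2 * unit_vec (-1) i + 1/2 * unit_vec 1 i)"
    | "p = (\<lambda>i. 1/2 * unit_vec (-1) i + 1/4 * unit_vec 0 i)"
    | "p = (\<lambda>i. 1/4 * unit_vec 0 i + 1/2 * unit_vec 1 i)"
    unfolding g_map_def by blast
  then show "p \<in> range (stop_vec N)"
  proof cases
    case 1
    then show ?thesis using sparing_vecs_add[OF assms] by auto
  next
    case 2
    then show ?thesis using unit_vec_0_in_range by simp
  next
    case 3
    then have "p = stop_vec N {[1], [-1]}"
      using stop_vec_time_1[of N "{[1], [-1]}"] assms by (auto simp: unit_vec_def)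
    then show ?thesis by simp
  next
    case 4
    then show ?thesis using one_sided[of 1] by simp
  next
    case 5
    then show ?thesis using one_sided[of "-1"] by (simp add: add.commute)
  qed
qed

section \<open>Contraction and uniqueness of the fixed point\<close>

text \<open>Uniqueness is Banach's argument: unfolding the equation \<open>n\<close> times in both sets with the same
  choices of \<open>q\<close> leaves an error of \<open>4\<^sup>-\<^sup>n\<close>.\<close>

lemma self_similar_subset:
  fixes A B :: "(int \<Rightarrow> real) set"
  assumes A: "closed A" "A \<subseteq> unit_cube N" "A = (\<Union>q\<in>W. (\<lambda>p i. 1/4 * p i + q i) ` A) \<union> g_map A"
    and B: "B \<subseteq> unit_cube N" "B = (\<Union>q\<in>W. (\<lambda>p i. 1/4 * p i + q i) ` B) \<union> g_map B"
  shows "B \<subseteq> A"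
proof
  fix p assume p: "p \<in> B"
  have "\<exists>a\<in>A. \<forall>i. \<bar>p i - a i\<bar> \<le> (1/4) ^ n" if "p \<in> B" for n p
    using that
  proof (induction n arbitrary: p)
    case 0
    \<comment> \<open>\<open>g_map\<close> supplies a point of \<open>A\<close>, and two points of
      the cube differ by at most 1 in each coordinate.\<close>
    have "unit_vec 0 \<in> A" by (subst A(3)) (simp add: g_map_def)
    moreover have "\<bar>p i - unit_vec 0 i\<bar> \<le> 1" for i
    proof -
      have "p \<in> unit_cube N" using B(1) 0 by blast
      then have "p i \<in> {0..1}" by (cases "i \<in> {-int N..int N}") (auto simp: unit_cube_def)
      then show ?thesis by (auto simp: unit_vec_def)
    qed
    ultimately show ?case by auto
  next
    case (Suc n)
    then consider q b where "q \<in> W" "b \<in> B" "p = (\<lambda>i. 1/4 * b i + q i)" | "p \<in> g_map B"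
      using B(2) by blast
    then show ?case
    proof cases
      case 1
      from Suc.IH[OF 1(2)] obtain a where a: "a \<in> A" "\<forall>i. \<bar>b i - a i\<bar> \<le> (1/4) ^ n" by blast
      have "(\<lambda>i. 1/4 * a i + q i) \<in> A" by (subst A(3)) (use a(1) 1(1) in blast)
      moreover have "\<bar>p i - (1/4 * a i + q i)\<bar> \<le> (1/4) ^ Suc n" for i
      proof -
        have "p i - (1/4 * a i + q i) = 1/4 * (b i - a i)" by (simp add: 1(3) algebra_simps)
        then have "\<bar>p i - (1/4 * a i + q i)\<bar> = 1/4 * \<bar>b i - a i\<bar>" by (simp only: abs_mult)
        then show ?thesis using a(2)[rule_format, of i] by simp
      qed
      ultimately show ?thesis by (intro bexI[of _ "\<lambda>i. 1/4 * a i + q i"] allI)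
    next
      case 2
      then have "p \<in> g_map A" by (simp add: g_map_def)
      then have "p \<in> A" by (subst A(3)) (rule UnI2)
      then show ?thesis by force
    qed
  qed
  then have "\<forall>n. \<exists>a. a \<in> A \<and> (\<forall>i. \<bar>p i - a i\<bar> \<le> (1/4) ^ n)" using p by blast
  then obtain a where a: "\<And>n. a n \<in> A" "\<And>n i. \<bar>p i - a n i\<bar> \<le> (1/4) ^ n" by metis
  have "(\<lambda>n. a n i) \<longlonglongrightarrow> p i" for i
  proof (rule LIM_zero_cancel, rule Lim_null_comparison)
    show "\<forall>\<^sub>F n in sequentially. norm (a n i - p i) \<le> (1/4) ^ n"
      using a(2) by (simp add: abs_minus_commute)
    show "(\<lambda>n. (1/4::real) ^ n) \<longlonglongrightarrow> 0" by (rule LIMSEQ_power_zero) simp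
  qed
  then have "limitin (product_topology (\<lambda>_. euclidean) UNIV) a p sequentially"
    by (simp add: limitin_componentwise)
  then have "a \<longlonglongrightarrow> p" by (simp add: euclidean_product_topology)
  then show "p \<in> A"
    using a(1) by (intro Lim_in_closed_set[OF A(1) _ sequentially_bot]) (simp_all add: eventually_sequentially)
qed

text \<open>An infinite union of closed sets need not be closed; this one is the continuous image of
  the compact product \<open>W \<times> A\<close>.\<close>

lemma closed_f_image:
  fixes A W :: "(int \<Rightarrow> real) set"
  assumes "compact A" "compact W"
  shows "closed ((\<Union>q\<in>W. (\<lambda>p i. 1/4 * p i + q i) ` A) \<union> g_map A)"
proof (intro closed_Un)
  have "continuous_on (W \<times> A) (\<lambda>z. fst z i)" "continuous_on (W \<times> A) (\<lambda>z. snd z i)" for i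
    by (rule continuous_on_product_then_coordinatewise, rule continuous_on_fst continuous_on_snd,
        rule continuous_on_id)+
  then have "continuous_on (W \<times> A) (\<lambda>z i. 1/4 * snd z i + fst z i)"
    by (intro continuous_on_coordinatewise_then_product continuous_on_add continuous_on_mult_left)
  then have "compact ((\<lambda>z i. 1/4 * snd z i + fst z i) ` (W \<times> A))"
    using assms by (intro compact_continuous_image compact_Times)
  moreover have "(\<lambda>z i. 1/4 * snd z i + fst z i) ` (W \<times> A) = (\<Union>q\<in>W. (\<lambda>p i. 1/4 * p i + q i) ` A)"
    by force
  ultimately show "closed (\<Union>q\<in>W. (\<lambda>p i. 1/4 * p i + q i) ` A)"
    by (simp add: compact_imp_closed)
  show "closed (g_map A)"
    unfolding g_map_def by (intro finite_imp_closed) simp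
qed

text \<open>By Tychonoff; it makes every closed subset of the cube compact, as
  \<open>closed_f_image\<close> requires.\<close>

lemma compact_unit_cube: "compact (unit_cube N)"
proof -
  define C where "C = (\<Pi>\<^sub>E i\<in>UNIV. if i \<in> {-int N..int N} then {0..1::real} else {0})"
  have "compactin (product_topology (\<lambda>_. euclidean) UNIV) C"
    unfolding C_def by (subst compactin_PiE) auto
  moreover have "C = unit_cube N"
    by (auto simp: C_def unit_cube_def PiE_def Pi_def split: if_splits)
  ultimately show ?thesis by (simp add: euclidean_product_topology)
qed

section \<open>Prescribed numbers of stopped words\<close>

text \<open>\<open>T n X\<close> is the set of words to be stopped if \<open>X\<close> is the set of words arriving at time \<open>n\<close>.\<close>

primrec greedy_arrivals :: "nat \<Rightarrow> (nat \<Rightarrow> int list set \<Rightarrow> int list set) \<Rightarrow> nat \<Rightarrow> int list set" where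
  "greedy_arrivals N T 0 = {[]}"
| "greedy_arrivals N T (Suc n) =
     {v @ [s] | v s. s \<in> {-1, 1} \<and> \<bar>sum_list v\<bar> \<le> int N \<and>
        v \<in> greedy_arrivals N T n - T n (greedy_arrivals N T n)}"

text \<open>Which words arrive at time \<open>n\<close> depends only on the shorter words of
  \<open>D\<close>, so \<open>D\<close> can be chosen level by level, taking any
  \<open>b n i\<close> of the words that arrive at \<open>i\<close>.\<close>

lemma exists_stopping_set:
  "\<exists>D. \<forall>n i. \<bar>i\<bar> \<le> int N \<longrightarrow> b n i \<le> card (arriving N D n i) \<longrightarrow> card (stopped N D n i) = b n i"
proof -
  define sub where "sub X m = (SOME B. B \<subseteq> X \<and> card B = m)" for X :: "int list set" and m
  have sub: "sub X m \<subseteq> X" "card (sub X m) = m" if "m \<le> card X" for X m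
  proof -
    have "\<exists>B\<subseteq>X. card B = m" using that by (metis obtain_subset_with_card_n)
    then have "\<exists>B. B \<subseteq> X \<and> card B = m" by blast
    then have "sub X m \<subseteq> X \<and> card (sub X m) = m" unfolding sub_def by (rule someI_ex)
    then show "sub X m \<subseteq> X" "card (sub X m) = m" by auto
  qed
  \<comment> \<open>The filter \<open>w \<in> X\<close> keeps \<open>T n X\<close> inside
    \<open>X\<close> even where too few words arrive and \<open>sub\<close> is an arbitrary
    value.\<close>
  define T where "T n X = {w \<in> X. w \<in> sub {v \<in> X. sum_list v = sum_list w} (b n (sum_list w))}"
    for n X
  define A where "A = greedy_arrivals N T"
  define D where "D = (\<Union>n. T n (A n))"
  have A_Suc: "A (Suc n) = {v @ [s] | v s. s \<in> {-1, 1} \<and> \<bar>sum_list v\<bar> \<le> int N \<and> v \<in> A n - T n (A n)}" for n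
    by (simp add: A_def)
  have len: "w \<in> A n \<Longrightarrow> length w = n" for w n
    by (induction n arbitrary: w) (auto simp: A_Suc, simp add: A_def)
  \<comment> \<open>The levels do not interfere: a word of \<open>A n\<close> has length
    \<open>n\<close> and can enter \<open>D\<close> only at level \<open>n\<close>.\<close>
  have D_iff: "w \<in> D \<longleftrightarrow> w \<in> T n (A n)" if "w \<in> A n" for w n
    using len that by (auto simp: D_def T_def)
  have arr: "arriving N D n i = {w \<in> A n. sum_list w = i}" for n i
  proof (induction n arbitrary: i)
    case 0
    then show ?case by (auto simp: arriving_0 A_def)
  next
    case (Suc n)
    have "w \<in> arriving N D (Suc n) i \<longleftrightarrow> w \<in> A (Suc n) \<and> sum_list w = i" for w
    proof (cases w rule: rev_exhaust)
      case Nil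
      then show ?thesis by (auto simp: A_Suc arriving_Suc)
    next
      case (snoc v s)
      have "w \<in> arriving N D (Suc n) i \<longleftrightarrow> s \<in> {-1, 1} \<and> v \<in> continuing N D n (i - s)"
        by (simp only: snoc snoc_in_arriving)
      also have "\<dots> \<longleftrightarrow> s \<in> {-1, 1} \<and> \<bar>i - s\<bar> \<le> int N \<and> v \<in> A n \<and> sum_list v = i - s \<and> v \<notin> D"
        by (auto simp: continuing_def Suc.IH)
      also have "\<dots> \<longleftrightarrow> w \<in> A (Suc n) \<and> sum_list w = i"
        using D_iff[of v n] by (auto simp: A_Suc snoc)
      finally show ?thesis .
    qed
    then show ?case by blast
  qed
  have "card (stopped N D n i) = b n i" if "b n i \<le> card (arriving N D n i)" for n i
  proof -
    have "stopped N D n i = sub {v \<in> A n. sum_list v = i} (b n i)"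
      using sub(1)[OF that] D_iff[of _ n] unfolding stopped_def arr T_def by blast
    then show ?thesis using sub(2)[OF that] by (simp add: arr)
  qed
  then show ?thesis by blast
qed

section \<open>Walk time and the indices of the counts\<close>

text \<open>The walk is at an even site \<open>i\<close> only at even times, at an odd one only at odd times; the
  index \<open>n\<close> of the counts refers to this time. (For \<open>n = 0\<close> and odd \<open>i\<close> the subtraction is
  truncated to time 0, where no path is at \<open>i\<close>.)\<close>

definition count_time :: "nat \<Rightarrow> int \<Rightarrow> nat" where
  "count_time n i = (if even i then 2 * n else 2 * n - 1)"

lemma stopped_empty: "odd (i + int n) \<Longrightarrow> stopped N D n i = {}"
  by (simp add: stopped_def arriving_empty)

text \<open>Times of the wrong parity contribute nothing. At an even site time 2j has weight 4^-j,
  at an odd site time 2j - 1 has weight 2 * 4^-j, which is the origin of the factor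
  \<open>2 ^ nat (i mod 2)\<close>.\<close>

lemma stopped_count_sums:
  assumes i: "\<bar>i\<bar> \<le> int N"
  shows "(\<lambda>j. 2 ^ nat (i mod 2) * (real (card (stopped N D (count_time j i) i)) / 4 ^ j))
    sums stop_vec N D i"
proof -
  let ?f = "\<lambda>n. real (card (stopped N D n i)) / 2 ^ n"
  have f: "?f sums stop_vec N D i" by (rule stopped_sums[OF i])
  show ?thesis
  proof (cases "even i")
    case True
    have "(\<lambda>j. ?f (2 * j)) sums stop_vec N D i"
    proof (subst sums_mono_reindex[of "\<lambda>j. 2 * j" ?f])
      show "strict_mono ((*) (2::nat))" by (simp add: strict_mono_def)
      fix n :: nat assume "n \<notin> range ((*) 2)"
      then have "odd n" by (auto elim!: evenE)
      then show "?f n = 0" using True by (simp add: stopped_empty)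
    qed (rule f)
    then show ?thesis
      using True by (simp add: count_time_def power_mult even_iff_mod_2_eq_zero)
  next
    case False
    have "(\<lambda>j. ?f (2 * j + 1)) sums stop_vec N D i"
    proof (subst sums_mono_reindex[of "\<lambda>j. 2 * j + 1" ?f])
      show "strict_mono (\<lambda>j::nat. 2 * j + 1)" by (simp add: strict_mono_def)
      fix n :: nat assume "n \<notin> range (\<lambda>j. 2 * j + 1)"
      then have "even n" by (metis oddE rangeI)
      then show "?f n = 0" using False by (simp add: stopped_empty)
    qed (rule f)
    \<comment> \<open>Since 2j + 1 = 2(j + 1) - 1, the reindexed series starts at index 1; the term
      of index 0 vanishes and is put back below.\<close>
    then have "(\<lambda>j. 2 * (real (card (stopped N D (count_time (Suc j) i) i)) / 4 ^ Suc j)) sums stop_vec N D i"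
      using False by (simp add: count_time_def power_mult)
    moreover have "stopped N D (count_time 0 i) i = {}"
      using False by (auto simp: count_time_def intro!: stopped_empty)
    ultimately show ?thesis
      using False by (subst (asm) sums_Suc_iff) (simp add: odd_iff_mod_2_eq_one)
  qed
qed

text \<open>Both rules merge into one recursion in the walk time \<open>m\<close>: times 2n - 1 and
  2n share the row \<open>n\<close>, so time \<open>m\<close> belongs to row
  \<open>(m + 1) div 2\<close>.\<close>

lemma arrival_counts_iff:
  "arrival_counts N a k \<longleftrightarrow> (\<forall>i. \<bar>i\<bar> \<le> int N \<longrightarrow> k 0 i = (if i = 0 then 1 else 0)) \<and>
     (\<forall>m i. \<bar>i\<bar> \<le> int N \<longrightarrow> even (i + int (Suc m)) \<longrightarrow>
        k ((m + 2) div 2) i = remaining N a k ((m + 1) div 2) (i - 1) + remaining N a k ((m + 1) div 2) (i + 1))"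
    (is "_ \<longleftrightarrow> ?Z \<and> ?R")
proof -
  have mem: "i \<in> {-int N..int N} \<longleftrightarrow> \<bar>i\<bar> \<le> int N" for i by auto
  show ?thesis
  proof
    assume ac: "arrival_counts N a k"
    have ?R
    proof (intro allI impI)
      fix m i assume i: "\<bar>i\<bar> \<le> int N" "even (i + int (Suc m))"
      show "k ((m + 2) div 2) i = remaining N a k ((m + 1) div 2) (i - 1) + remaining N a k ((m + 1) div 2) (i + 1)"
      proof (cases "even m")
        case True
        then obtain n where n: "m = 2 * n" by (rule evenE)
        have "odd i" using i(2) True by simp
        then obtain l where l: "i = 2 * l + 1" by (rule oddE)
        have "k (n + 1) (2 * l + 1) = remaining N a k n (2 * l) + remaining N a k n (2 * (l + 1))"
          using ac i(1) unfolding arrival_counts_def mem l by blast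
        then show ?thesis by (simp add: n l algebra_simps)
      next
        case False
        then obtain n where n: "m = 2 * n + 1" by (rule oddE)
        have "even i" using i(2) False by simp
        then obtain l where l: "i = 2 * l" by (rule evenE)
        have "k (n + 1) (2 * l) = remaining N a k (n + 1) (2 * l + 1) + remaining N a k (n + 1) (2 * l - 1)"
          using ac i(1) unfolding arrival_counts_def mem l by blast
        then show ?thesis by (simp add: n l algebra_simps)
      qed
    qed
    moreover have ?Z using ac unfolding arrival_counts_def Ball_def mem by blast
    ultimately show "?Z \<and> ?R" by blast
  next
    assume a: "?Z \<and> ?R"
    have "k (n + 1) (2 * l + 1) = remaining N a k n (2 * l) + remaining N a k n (2 * (l + 1))"
      if "\<bar>2 * l + 1\<bar> \<le> int N" for n l
      using a[THEN conjunct2, rule_format, OF that, of "2 * n"] by (simp add: algebra_simps)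
    moreover have "k (n + 1) (2 * l) = remaining N a k (n + 1) (2 * l + 1) + remaining N a k (n + 1) (2 * l - 1)"
      if "\<bar>2 * l\<bar> \<le> int N" for n l
      using a[THEN conjunct2, rule_format, OF that, of "2 * n + 1"] by (simp add: algebra_simps)
    ultimately show "arrival_counts N a k" using a unfolding arrival_counts_def Ball_def mem by blast
  qed
qed

text \<open>With \<open>k\<close> counting the arriving words, the recursion is the decomposition of
  a word by its last step, and the inequality holds because stopped words are among the arriving
  ones.\<close>

lemma stopping_set_counts:
  "\<exists>a k. arrival_counts N a k \<and>
     (\<forall>i\<in>{-int N..int N}. \<forall>n. a n i = card (stopped N D (count_time n i) i) \<and> int (a n i) \<le> k n i)"
proof -
  define a where "a n i = card (stopped N D (count_time n i) i)" for n i
  define k where "k n i = int (card (arriving N D (count_time n i) i))" for n i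
  have "a n i \<le> card (arriving N D (count_time n i) i)" for n i
    unfolding a_def stopped_def by (rule card_mono[OF finite_arriving]) simp
  then have le: "int (a n i) \<le> k n i" for n i by (simp add: k_def)
  have ct: "count_time ((m + 1) div 2) i = m" if "even (i + int m)" for m i
    using that by (auto simp: count_time_def elim!: evenE oddE)
  have rem: "remaining N a k ((m + 1) div 2) i = int (card (continuing N D m i))"
    if "even (i + int m)" for m i
  proof (cases "\<bar>i\<bar> \<le> int N")
    case True
    then show ?thesis
      using card_continuing[OF True, of D m] unfolding remaining_def a_def k_def ct[OF that] by simp
  qed (simp add: remaining_def continuing_def)
  have "arrival_counts N a k"
    unfolding arrival_counts_iff
  proof (intro conjI allI impI)
    show "k 0 i = (if i = 0 then 1 else 0)" for i
      by (simp add: k_def count_time_def arriving_0)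
    fix m i assume i: "even (i + int (Suc m))"
    have "k ((m + 2) div 2) i = int (card (arriving N D (Suc m) i))"
      using ct[OF i] by (simp add: k_def)
    then show "k ((m + 2) div 2) i = remaining N a k ((m + 1) div 2) (i - 1) + remaining N a k ((m + 1) div 2) (i + 1)"
      using i rem[of "i - 1" m] rem[of "i + 1" m] by (simp add: card_arriving_Suc)
  qed
  then show ?thesis using le a_def by blast
qed

text \<open>\<open>exists_stopping_set\<close> delivers the prescribed numbers only where enough
  words arrive. By induction on time the arrivals agree with \<open>k\<close>: as long as they do,
  the bound by \<open>k\<close> makes the prescription effective, and the recursion carries the
  agreement to the next time.\<close>

lemma counts_stopping_set:
  assumes ac: "arrival_counts N a k" and le: "\<And>n i. \<bar>i\<bar> \<le> int N \<Longrightarrow> int (a n i) \<le> k n i"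
  shows "\<exists>D. \<forall>n i. \<bar>i\<bar> \<le> int N \<longrightarrow> a n i = card (stopped N D (count_time n i) i)"
proof -
  obtain D where D: "\<And>n i. \<bar>i\<bar> \<le> int N \<Longrightarrow> a ((n + 1) div 2) i \<le> card (arriving N D n i)
      \<Longrightarrow> card (stopped N D n i) = a ((n + 1) div 2) i"
    using exists_stopping_set[of N "\<lambda>n. a ((n + 1) div 2)"] by blast
  note ac' = ac[unfolded arrival_counts_iff]
  have arr: "int (card (arriving N D m i)) = k ((m + 1) div 2) i"
    if "\<bar>i\<bar> \<le> int N" "even (i + int m)" for m i
    using that
  proof (induction m arbitrary: i)
    case 0
    then show ?case using ac'[THEN conjunct1] by (auto simp: arriving_0)
  next
    case (Suc m)
    have rem: "int (card (continuing N D m j)) = remaining N a k ((m + 1) div 2) j"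
      if "even (j + int m)" for j
    proof (cases "\<bar>j\<bar> \<le> int N")
      case True
      note IH = Suc.IH[OF True that]
      have "int (a ((m + 1) div 2) j) \<le> int (card (arriving N D m j))"
        using le[OF True, of "(m + 1) div 2"] IH by (simp only:)
      then have "card (stopped N D m j) = a ((m + 1) div 2) j"
        by (intro D True) (simp only: of_nat_le_iff)
      then show ?thesis using card_continuing[OF True, of D m] IH True by (simp add: remaining_def)
    qed (simp add: remaining_def continuing_def)
    have "k ((m + 2) div 2) i = remaining N a k ((m + 1) div 2) (i - 1) + remaining N a k ((m + 1) div 2) (i + 1)"
      using ac'[THEN conjunct2] Suc.prems by blast
    then show ?case
      using rem[of "i - 1"] rem[of "i + 1"] Suc.prems by (simp add: card_arriving_Suc)
  qed
  have "a n i = card (stopped N D (count_time n i) i)" if i: "\<bar>i\<bar> \<le> int N" for n i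
  proof (cases "odd i \<and> n = 0")
    case True
    \<comment> \<open>Row 0 of an odd site belongs to no time of the walk: the bound by
      \<open>k 0 i = 0\<close> forces the entry to vanish, and no word of length 0 ends at an odd
      site.\<close>
    then have "k 0 i = 0" using ac'[THEN conjunct1] i by auto
    then have "a n i = 0" using le[OF i, of 0] True by simp
    moreover have "stopped N D (count_time n i) i = {}"
      using True by (intro stopped_empty) (simp add: count_time_def)
    ultimately show ?thesis by simp
  next
    case False
    then have "even (i + int (count_time n i))" by (auto simp: count_time_def of_nat_diff)
    moreover have n: "(count_time n i + 1) div 2 = n" using False by (auto simp: count_time_def)
    ultimately have "int (card (arriving N D (count_time n i) i)) = k n i"
      using arr[OF i] by metis
    then have "int (a n i) \<le> int (card (arriving N D (count_time n i) i))" using le[OF i, of n] by simp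
    then show ?thesis using D[OF i, of "count_time n i"] by (simp only: n of_nat_le_iff)
  qed
  then show ?thesis by blast
qed

section \<open>The law of the first steps\<close>

definition steps :: "(nat \<Rightarrow> 'a \<Rightarrow> int) \<Rightarrow> nat \<Rightarrow> 'a \<Rightarrow> int list" where
  "steps \<xi> n \<omega> = map (\<lambda>k. \<xi> k \<omega>) [1..<Suc n]"

lemma steps_0: "steps \<xi> 0 \<omega> = []"
  by (simp add: steps_def)

lemma steps_Suc: "steps \<xi> (Suc n) \<omega> = steps \<xi> n \<omega> @ [\<xi> (Suc n) \<omega>]"
  by (simp add: steps_def)

lemma length_steps [simp]: "length (steps \<xi> n \<omega>) = n"
  by (simp add: steps_def)

lemma take_steps: "m \<le> n \<Longrightarrow> take m (steps \<xi> n \<omega>) = steps \<xi> m \<omega>"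
  by (induction n) (auto simp: steps_Suc steps_0 le_Suc_eq)

lemma nth_steps: "k < n \<Longrightarrow> steps \<xi> n \<omega> ! k = \<xi> (Suc k) \<omega>"
  by (simp add: steps_def del: upt_Suc)

lemma sum_list_steps: "sum_list (steps \<xi> n \<omega>) = walk \<xi> n \<omega>"
  by (induction n) (simp_all add: walk_def steps_Suc steps_0)

lemma walk_Suc: "walk \<xi> (Suc n) \<omega> = walk \<xi> n \<omega> + \<xi> (Suc n) \<omega>"
  by (simp add: walk_def)

lemma sum_path_words_Suc:
  "(\<Sum>w\<in>path_words (Suc n). h w) = (\<Sum>v\<in>path_words n. h (v @ [1]) + h (v @ [-1]))"
  for h :: "int list \<Rightarrow> real"
proof -
  have "path_words (Suc n) = (\<lambda>v. v @ [-1]) ` path_words n \<union> (\<lambda>v. v @ [1]) ` path_words n"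
    by (auto simp: path_words_Suc)
  then have "(\<Sum>w\<in>path_words (Suc n). h w)
      = (\<Sum>w\<in>(\<lambda>v. v @ [-1]) ` path_words n. h w) + (\<Sum>w\<in>(\<lambda>v. v @ [1]) ` path_words n. h w)"
    by (simp only:) (intro sum.union_disjoint finite_imageI finite_path_words, auto)
  also have "\<dots> = (\<Sum>v\<in>path_words n. h (v @ [-1])) + (\<Sum>v\<in>path_words n. h (v @ [1]))"
    by (simp add: sum.reindex inj_on_def)
  finally show ?thesis by (simp add: sum.distrib)
qed

context simple_random_walk
begin

lemma measurable_step [measurable]: "k \<ge> 1 \<Longrightarrow> \<xi> k \<in> M \<rightarrow>\<^sub>M count_space UNIV"
  using indep_steps by (auto simp: indep_vars_def)

lemma measurable_steps_append:
  assumes "steps \<xi> n \<in> N \<rightarrow>\<^sub>M count_space UNIV" "\<xi> (Suc n) \<in> N \<rightarrow>\<^sub>M count_space UNIV"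
  shows "steps \<xi> (Suc n) \<in> N \<rightarrow>\<^sub>M count_space UNIV"
proof -
  have "(\<lambda>\<omega>. steps \<xi> n \<omega> @ [\<xi> (Suc n) \<omega>]) \<in> N \<rightarrow>\<^sub>M count_space UNIV"
  proof (rule measurable_compose_countable[OF _ assms(1)])
    show "(\<lambda>\<omega>. w @ [\<xi> (Suc n) \<omega>]) \<in> N \<rightarrow>\<^sub>M count_space UNIV" for w
      by (rule measurable_compose[OF assms(2)]) simp
  qed
  then show ?thesis by (subst measurable_cong[OF steps_Suc])
qed

lemma measurable_steps [measurable]: "steps \<xi> n \<in> M \<rightarrow>\<^sub>M count_space UNIV"
proof (induction n)
  case 0
  have "steps \<xi> 0 = (\<lambda>_. [])" by (simp add: fun_eq_iff steps_0)
  then show ?case by simp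
qed (simp add: measurable_steps_append)

lemma measurable_walk [measurable]: "walk \<xi> n \<in> M \<rightarrow>\<^sub>M count_space UNIV"
proof -
  have "(\<lambda>\<omega>. sum_list (steps \<xi> n \<omega>)) \<in> M \<rightarrow>\<^sub>M count_space UNIV"
    by (rule measurable_compose[OF measurable_steps]) simp
  then show ?thesis by (simp add: sum_list_steps)
qed

lemma prob_step:
  assumes "k \<ge> 1" "x \<in> {-1, 1}"
  shows "prob (\<xi> k -` {x} \<inter> space M) = 1/2"
proof -
  have "prob (\<xi> k -` {x} \<inter> space M) = measure (distr M (count_space UNIV) (\<xi> k)) {x}"
    using assms by (subst measure_distr) auto
  also have "\<dots> = pmf (pmf_of_set {-1, 1}) x"
    using distr_step[OF assms(1)] by (simp add: pmf.rep_eq)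
  also have "\<dots> = 1/2" using assms(2) by (subst pmf_of_set) auto
  finally show ?thesis .
qed

lemma prob_steps_eq:
  assumes w: "w \<in> path_words n"
  shows "prob {\<omega> \<in> space M. steps \<xi> n \<omega> = w} = 1 / 2 ^ n"
\<comment> \<open>For \<open>n = 0\<close> the intersection over the empty index set need not lie in
  \<open>space M\<close>.\<close>
proof (cases "n = 0")
  case True
  then show ?thesis using w prob_space by (simp add: path_words_def steps_0)
next
  case False
  have len: "length w = n" and sub: "set w \<subseteq> {-1, 1}" using w by (auto simp: path_words_def)
  have mem: "w ! k \<in> {-1, 1}" if "k < n" for k
    using nth_mem[of k w] len sub that by blast
  have "{\<omega> \<in> space M. steps \<xi> n \<omega> = w} = (\<Inter>k\<in>{1..n}. \<xi> k -` {w ! (k - 1)} \<inter> space M)"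
  proof (intro equalityI subsetI)
    fix \<omega> assume a: "\<omega> \<in> (\<Inter>k\<in>{1..n}. \<xi> k -` {w ! (k - 1)} \<inter> space M)"
    then have "\<omega> \<in> space M" using False by auto
    moreover have "steps \<xi> n \<omega> = w"
    proof (rule nth_equalityI)
      fix k assume "k < length (steps \<xi> n \<omega>)"
      then show "steps \<xi> n \<omega> ! k = w ! k" using a by (force simp: nth_steps)
    qed (simp add: len)
    ultimately show "\<omega> \<in> {\<omega> \<in> space M. steps \<xi> n \<omega> = w}" by simp
  qed (auto simp: nth_steps)
  then have "prob {\<omega> \<in> space M. steps \<xi> n \<omega> = w} = (\<Prod>k\<in>{1..n}. prob (\<xi> k -` {w ! (k - 1)} \<inter> space M))"
    using False by (simp only:) (intro indep_varsD[OF indep_steps], auto)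
  also have "\<dots> = (\<Prod>k\<in>{1..n}. 1/2)"
    by (intro prod.cong refl prob_step mem) auto
  finally show ?thesis by (simp add: power_divide)
qed

lemma prob_steps_in:
  assumes "B \<subseteq> path_words n"
  shows "prob {\<omega> \<in> space M. steps \<xi> n \<omega> \<in> B} = real (card B) / 2 ^ n"
proof -
  have "{\<omega> \<in> space M. steps \<xi> n \<omega> \<in> B} = (\<Union>w\<in>B. {\<omega> \<in> space M. steps \<xi> n \<omega> = w})" by auto
  moreover have "prob (\<Union>w\<in>B. {\<omega> \<in> space M. steps \<xi> n \<omega> = w})
      = (\<Sum>w\<in>B. prob {\<omega> \<in> space M. steps \<xi> n \<omega> = w})"
    using finite_subset[OF assms finite_path_words]
    by (intro finite_measure_finite_Union) (auto simp: disjoint_family_on_def)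
  moreover have "\<dots> = (\<Sum>w\<in>B. 1 / 2 ^ n)" using assms by (intro sum.cong prob_steps_eq) auto
  ultimately show ?thesis by simp
qed

text \<open>Steps may take other values on a null set, so statements about words hold almost surely;
  one exceptional set serves all \<open>n\<close>.\<close>

lemma AE_steps_path_words: "AE \<omega> in M. \<forall>n. steps \<xi> n \<omega> \<in> path_words n"
proof (subst AE_all_countable, rule allI)
  fix n
  have "prob {\<omega> \<in> space M. steps \<xi> n \<omega> \<in> path_words n} = 1"
    by (simp add: prob_steps_in card_path_words)
  then show "AE \<omega> in M. steps \<xi> n \<omega> \<in> path_words n"
    by (subst (asm) prob_Collect_eq_1) measurable
qed

text \<open>Only finitely many words have positive probability, so
  \<open>h (steps \<xi> n \<omega>)\<close> is almost surely a finite combination of indicators,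
  however large \<open>h\<close> may be elsewhere.\<close>

lemma steps_integral:
  fixes h :: "int list \<Rightarrow> real"
  shows integrable_steps: "integrable M (\<lambda>\<omega>. h (steps \<xi> n \<omega>))"
    and integral_steps: "(\<integral>\<omega>. h (steps \<xi> n \<omega>) \<partial>M) = (\<Sum>w\<in>path_words n. h w) / 2 ^ n"
proof -
  define g where "g \<omega> = (\<Sum>w\<in>path_words n. h w * indicator {\<omega> \<in> space M. steps \<xi> n \<omega> = w} \<omega>)" for \<omega>
  have ae: "AE \<omega> in M. h (steps \<xi> n \<omega>) = g \<omega>"
    using AE_steps_path_words AE_space
  proof eventually_elim
    case (elim \<omega>)
    then have "g \<omega> = (\<Sum>w\<in>path_words n. if w = steps \<xi> n \<omega> then h w else 0)"
      unfolding g_def by (intro sum.cong refl) (auto simp: indicator_def)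
    also have "\<dots> = h (steps \<xi> n \<omega>)" using elim by (simp add: finite_path_words)
    finally show ?case by simp
  qed
  have meas: "(\<lambda>\<omega>. h (steps \<xi> n \<omega>)) \<in> borel_measurable M"
    by (rule measurable_compose[OF measurable_steps]) simp
  have ind: "integrable M (\<lambda>\<omega>. h w * indicator {\<omega> \<in> space M. steps \<xi> n \<omega> = w} \<omega>)" for w
    by (intro integrable_mult_right integrable_real_indicator) (auto simp: emeasure_eq_measure)
  then have "integrable M g" unfolding g_def by (intro Bochner_Integration.integrable_sum)
  moreover have "(\<integral>\<omega>. g \<omega> \<partial>M) = (\<Sum>w\<in>path_words n. h w * prob {\<omega> \<in> space M. steps \<xi> n \<omega> = w})"
    unfolding g_def by (subst Bochner_Integration.integral_sum[OF ind]) (auto intro!: sum.cong simp: Int_def conj_commute)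
  ultimately show "integrable M (\<lambda>\<omega>. h (steps \<xi> n \<omega>))"
    "(\<integral>\<omega>. h (steps \<xi> n \<omega>) \<partial>M) = (\<Sum>w\<in>path_words n. h w) / 2 ^ n"
    using integrable_cong_AE[OF meas _ ae] integral_cong_AE[OF meas _ ae]
    by (auto simp: prob_steps_eq sum_divide_distrib)
qed

section \<open>The natural filtration and its stopping times\<close>

lemma space_walk_filtration [simp]: "space (walk_filtration M \<xi> t) = space M"
  unfolding walk_filtration_def by (rule space_measure_of) auto

lemma sets_walk_filtration:
  "sets (walk_filtration M \<xi> t)
     = sigma_sets (space M) {walk \<xi> m -` B \<inter> space M | m B. enat m \<le> t}"
  unfolding walk_filtration_def by (rule sets_measure_of) auto

lemma sets_walk_filtration_mono:
  "s \<le> t \<Longrightarrow> sets (walk_filtration M \<xi> s) \<subseteq> sets (walk_filtration M \<xi> t)"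
  unfolding sets_walk_filtration by (intro sigma_sets_mono') (auto intro: order_trans)

lemma sets_walk_filtration_subset: "sets (walk_filtration M \<xi> t) \<subseteq> sets M"
proof -
  have "walk \<xi> m -` B \<inter> space M \<in> sets M" for m B
    by (rule measurable_sets[OF measurable_walk]) simp
  then show ?thesis
    unfolding sets_walk_filtration by (intro sets.sigma_sets_subset) auto
qed

lemma subalgebra_walk_filtration: "subalgebra M (walk_filtration M \<xi> t)"
  using sets_walk_filtration_subset by (simp add: subalgebra_def)

text \<open>The property holds for the generators and survives complements and countable unions, at
  all points of the space and not just up to null sets. It lets a stopping time be read off a finite
  word.\<close>

lemma walk_filtration_determined:
  assumes "A \<in> sets (walk_filtration M \<xi> (enat n))" "\<omega> \<in> space M" "\<omega>' \<in> space M"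
    "steps \<xi> n \<omega> = steps \<xi> n \<omega>'"
  shows "\<omega> \<in> A \<longleftrightarrow> \<omega>' \<in> A"
proof -
  have w: "walk \<xi> m \<omega> = walk \<xi> m \<omega>'" if "m \<le> n" for m
    using assms(4) take_steps[OF that, of \<xi> \<omega>] take_steps[OF that, of \<xi> \<omega>'] by (metis sum_list_steps)
  from assms(1) show ?thesis
    unfolding sets_walk_filtration
    by (induction rule: sigma_sets.induct) (use assms(2,3) w in auto)
qed

text \<open>The filtration is generated by positions; steps are recovered as differences of
  consecutive positions.\<close>

lemma measurable_steps_walk_filtration:
  assumes "m \<le> n"
  shows "steps \<xi> m \<in> walk_filtration M \<xi> (enat n) \<rightarrow>\<^sub>M count_space UNIV"
  using assms
proof (induction m)
  case 0
  have "steps \<xi> 0 = (\<lambda>_. [])" by (simp add: fun_eq_iff steps_0)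
  then show ?case by simp
next
  case (Suc m)
  have walk: "walk \<xi> k \<in> walk_filtration M \<xi> (enat n) \<rightarrow>\<^sub>M count_space UNIV" if "k \<le> n" for k
  proof (rule measurableI)
    fix B assume "B \<in> sets (count_space UNIV :: int measure)"
    show "walk \<xi> k -` B \<inter> space (walk_filtration M \<xi> (enat n)) \<in> sets (walk_filtration M \<xi> (enat n))"
      unfolding space_walk_filtration unfolding sets_walk_filtration
      by (rule sigma_sets.Basic) (use that in auto)
  qed simp
  have "(\<lambda>\<omega>. walk \<xi> (Suc m) \<omega> - walk \<xi> m \<omega>) \<in> walk_filtration M \<xi> (enat n) \<rightarrow>\<^sub>M count_space UNIV"
    by (rule measurable_compose_countable[OF _ walk[of "Suc m"]])
      (rule measurable_compose[OF walk[of m]], use Suc.prems in auto)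
  moreover have "\<xi> (Suc m) = (\<lambda>\<omega>. walk \<xi> (Suc m) \<omega> - walk \<xi> m \<omega>)"
    by (simp add: fun_eq_iff walk_Suc)
  ultimately have "\<xi> (Suc m) \<in> walk_filtration M \<xi> (enat n) \<rightarrow>\<^sub>M count_space UNIV" by simp
  with Suc show ?case by (intro measurable_steps_append) auto
qed

lemma steps_event_in_walk_filtration:
  "m \<le> n \<Longrightarrow> {\<omega> \<in> space M. steps \<xi> m \<omega> \<in> B} \<in> sets (walk_filtration M \<xi> (enat n))"
  using measurable_sets[OF measurable_steps_walk_filtration[of m n], of B]
  by (simp add: vimage_def Int_def conj_commute)

lemma walk_filtration_event:
  assumes "A \<in> sets (walk_filtration M \<xi> (enat n))"
  obtains B where "A = {\<omega> \<in> space M. steps \<xi> n \<omega> \<in> B}"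
proof
  have "A \<subseteq> space M" using sets.sets_into_space[OF assms] by simp
  then show "A = {\<omega> \<in> space M. steps \<xi> n \<omega> \<in> steps \<xi> n ` A}"
    using walk_filtration_determined[OF assms] by blast
qed

lemma stopping_time_le_sets:
  assumes "stopping_time (walk_filtration M \<xi>) \<tau>"
  shows "{\<omega> \<in> space M. \<tau> \<omega> \<le> t} \<in> sets (walk_filtration M \<xi> t)"
  using stopping_timeD[OF assms, of t] by (simp add: pred_def)

lemma measurable_stopping_time_countable:
  assumes "stopping_time (walk_filtration M \<xi>) \<tau>"
  shows "\<tau> \<in> M \<rightarrow>\<^sub>M count_space UNIV"
proof -
  have le: "{\<omega> \<in> space M. \<tau> \<omega> \<le> t} \<in> sets M" for t
    using stopping_time_le_sets[OF assms, of t] sets_walk_filtration_subset by blast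
  have "\<tau> -` {t} \<inter> space M \<in> sets M" for t
  proof -
    have "\<tau> -` {t} \<inter> space M = {\<omega> \<in> space M. \<tau> \<omega> \<le> t} - (\<Union>s\<in>{..<t}. {\<omega> \<in> space M. \<tau> \<omega> \<le> s})"
      by (auto simp: order.order_iff_strict)
    then show ?thesis using le by (simp only:) (intro sets.Diff sets.countable_UN', auto)
  qed
  then show ?thesis by (subst measurable_count_space_eq_countable) auto
qed

lemma measurable_walk_at_stopping_time:
  assumes "stopping_time (walk_filtration M \<xi>) \<tau>"
  shows "(\<lambda>\<omega>. walk \<xi> (the_enat (\<tau> \<omega>)) \<omega>) \<in> M \<rightarrow>\<^sub>M count_space UNIV"
  by (rule measurable_compose_countable[OF measurable_walk])
    (rule measurable_compose[OF measurable_stopping_time_countable[OF assms]], simp)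

text \<open>The cylinder of a word has positive probability and so meets every event of probability
  one. This turns almost sure facts into facts about individual words.\<close>

lemma AE_and_word:
  assumes "AE \<omega> in M. P \<omega>" "w \<in> path_words n"
  shows "\<exists>\<omega>\<in>space M. P \<omega> \<and> steps \<xi> n \<omega> = w"
proof (rule ccontr)
  assume a: "\<not> ?thesis"
  have "AE \<omega> in M. steps \<xi> n \<omega> \<noteq> w"
    using assms(1) AE_space by eventually_elim (use a in auto)
  then have "prob {\<omega> \<in> space M. steps \<xi> n \<omega> = w} = 0"
    by (subst prob_Collect_eq_0) auto
  then show False using prob_steps_eq[OF assms(2)] by simp
qed

end

section \<open>From sets of words to embeddings\<close>

definition hitting :: "(nat \<Rightarrow> 'a \<Rightarrow> int) \<Rightarrow> int list set \<Rightarrow> 'a \<Rightarrow> enat" where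
  "hitting \<xi> E \<omega> = (if \<exists>n. steps \<xi> n \<omega> \<in> E then enat (LEAST n. steps \<xi> n \<omega> \<in> E) else \<infinity>)"

lemma hitting_eq_iff:
  "hitting \<xi> E \<omega> = enat n \<longleftrightarrow> steps \<xi> n \<omega> \<in> E \<and> (\<forall>m<n. steps \<xi> m \<omega> \<notin> E)"
proof
  assume h: "hitting \<xi> E \<omega> = enat n"
  then have "\<exists>n. steps \<xi> n \<omega> \<in> E" and n: "n = (LEAST n. steps \<xi> n \<omega> \<in> E)"
    by (auto simp: hitting_def split: if_splits)
  then show "steps \<xi> n \<omega> \<in> E \<and> (\<forall>m<n. steps \<xi> m \<omega> \<notin> E)"
    by (metis (mono_tags, lifting) LeastI_ex not_less_Least)
next
  assume h: "steps \<xi> n \<omega> \<in> E \<and> (\<forall>m<n. steps \<xi> m \<omega> \<notin> E)"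
  then have "(LEAST n. steps \<xi> n \<omega> \<in> E) = n"
    by (intro Least_equality) (auto simp flip: not_less)
  then show "hitting \<xi> E \<omega> = enat n" using h by (auto simp: hitting_def)
qed

lemma hitting_le_iff: "hitting \<xi> E \<omega> \<le> enat n \<longleftrightarrow> (\<exists>m\<le>n. steps \<xi> m \<omega> \<in> E)"
proof
  assume "hitting \<xi> E \<omega> \<le> enat n"
  then obtain k where "hitting \<xi> E \<omega> = enat k" "k \<le> n" by (cases "hitting \<xi> E \<omega>") auto
  then show "\<exists>m\<le>n. steps \<xi> m \<omega> \<in> E" by (auto simp: hitting_eq_iff)
next
  assume "\<exists>m\<le>n. steps \<xi> m \<omega> \<in> E"
  then show "hitting \<xi> E \<omega> \<le> enat n" by (auto simp: hitting_def intro: order_trans[OF Least_le])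
qed

lemma stopped_walk_Suc:
  "stopped_walk \<xi> \<tau> (Suc n) \<omega>
     = stopped_walk \<xi> \<tau> n \<omega> + (if \<tau> \<omega> \<le> enat n then 0 else real_of_int (\<xi> (Suc n) \<omega>))"
  by (cases "\<tau> \<omega>") (auto simp: stopped_walk_def walk_Suc min_def)

lemma stopped_walk_0: "stopped_walk \<xi> \<tau> 0 \<omega> = 0"
  by (cases "\<tau> \<omega>") (simp_all add: stopped_walk_def walk_def)

text \<open>Displays the stopped walk as a function of the word of the first \<open>n\<close> steps,
  which gives adaptedness and integrability.\<close>

lemma stopped_walk_hitting:
  "stopped_walk \<xi> (hitting \<xi> E) n \<omega> = (\<Sum>k<n. if \<exists>m\<le>k. take m (steps \<xi> n \<omega>) \<in> E then 0
      else real_of_int (steps \<xi> n \<omega> ! k))"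
proof -
  have "stopped_walk \<xi> (hitting \<xi> E) n \<omega>
      = (\<Sum>k<n. if hitting \<xi> E \<omega> \<le> enat k then 0 else real_of_int (\<xi> (Suc k) \<omega>))"
    by (induction n) (simp_all add: stopped_walk_Suc stopped_walk_0)
  also have "\<dots> = (\<Sum>k<n. if \<exists>m\<le>k. take m (steps \<xi> n \<omega>) \<in> E then 0
      else real_of_int (steps \<xi> n \<omega> ! k))"
    by (intro sum.cong refl) (auto simp: hitting_le_iff nth_steps take_steps)
  finally show ?thesis .
qed

context simple_random_walk
begin

lemma stopping_time_hitting: "stopping_time (walk_filtration M \<xi>) (hitting \<xi> E)"
  unfolding stopping_time_def
proof
  fix t
  show "Measurable.pred (walk_filtration M \<xi> t) (\<lambda>\<omega>. hitting \<xi> E \<omega> \<le> t)"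
  proof (cases t)
    case (enat n)
    have "{\<omega> \<in> space M. hitting \<xi> E \<omega> \<le> enat n} = (\<Union>m\<le>n. {\<omega> \<in> space M. steps \<xi> m \<omega> \<in> E})"
      by (auto simp: hitting_le_iff)
    also have "\<dots> \<in> sets (walk_filtration M \<xi> (enat n))"
      by (intro sets.finite_UN steps_event_in_walk_filtration) auto
    finally show ?thesis by (simp add: pred_def enat)
  qed simp
qed

text \<open>It suffices to compare consecutive times on an event of the past. Such an event is a
  condition on the first \<open>n\<close> steps, the increment is a function of these steps times
  the next one, and the contributions of the next step 1 and -1 cancel.\<close>

lemma martingale_stopped_hitting:
  "martingale M (\<lambda>n. walk_filtration M \<xi> (enat n)) (stopped_walk \<xi> (hitting \<xi> E))"
    (is "martingale M ?F ?Y")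
  unfolding martingale_def
proof (intro conjI allI impI)
  define G where "G n w = (\<Sum>k<n. if \<exists>m\<le>k. take m w \<in> E then 0 else real_of_int (w ! k))"
    for n and w :: "int list"
  have Y: "?Y n = (\<lambda>\<omega>. G n (steps \<xi> n \<omega>))" for n
    by (rule ext) (simp add: stopped_walk_hitting G_def)
  show meas: "?Y n \<in> borel_measurable (?F n)" for n
    unfolding Y by (rule measurable_compose[OF measurable_steps_walk_filtration]) simp_all
  show int: "integrable M (?Y n)" for n
    unfolding Y by (rule integrable_steps)
  have step: "(LINT \<omega>:A|M. ?Y (Suc n) \<omega>) = (LINT \<omega>:A|M. ?Y n \<omega>)" if A: "A \<in> sets (?F n)" for A n
  proof -
    obtain B where B: "A = {\<omega> \<in> space M. steps \<xi> n \<omega> \<in> B}" using walk_filtration_event[OF A] .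
    define h where "h v = indicator B v * (if \<exists>m\<le>n. take m v \<in> E then 0 else 1::real)" for v
    have "(LINT \<omega>:A|M. ?Y (Suc n) \<omega>) - (LINT \<omega>:A|M. ?Y n \<omega>)
        = (\<integral>\<omega>. indicator A \<omega> * ?Y (Suc n) \<omega> - indicator A \<omega> * ?Y n \<omega> \<partial>M)"
      using A sets_walk_filtration_subset int unfolding set_lebesgue_integral_def
      by (subst Bochner_Integration.integral_diff)
        (auto intro!: integrable_mult_indicator[where 'b = real, simplified])
    also have "\<dots> = (\<integral>\<omega>. h (take n (steps \<xi> (Suc n) \<omega>)) * real_of_int (steps \<xi> (Suc n) \<omega> ! n) \<partial>M)"
    proof (rule Bochner_Integration.integral_cong[OF refl])
      fix \<omega> assume "\<omega> \<in> space M"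
      then have "indicator A \<omega> = (indicator B (steps \<xi> n \<omega>) :: real)" by (simp add: B indicator_def)
      then show "indicator A \<omega> * ?Y (Suc n) \<omega> - indicator A \<omega> * ?Y n \<omega>
          = h (take n (steps \<xi> (Suc n) \<omega>)) * real_of_int (steps \<xi> (Suc n) \<omega> ! n)"
        by (auto simp: stopped_walk_Suc hitting_le_iff take_steps h_def nth_steps algebra_simps)
    qed
    also have "\<dots> = (\<Sum>w\<in>path_words (Suc n). h (take n w) * real_of_int (w ! n)) / 2 ^ Suc n"
      by (rule integral_steps)
    also have "(\<Sum>w\<in>path_words (Suc n). h (take n w) * real_of_int (w ! n)) = 0"
      unfolding sum_path_words_Suc
      by (rule sum.neutral) (auto simp: path_words_def nth_append)
    finally show ?thesis by simp
  qed
  fix m n :: nat assume mn: "m \<le> n"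
  interpret F: finite_measure_subalgebra M "?F m"
    by unfold_locales (rule subalgebra_walk_filtration)
  show "AE \<omega> in M. real_cond_exp M (?F m) (?Y n) \<omega> = ?Y m \<omega>"
  proof (rule F.real_cond_exp_charact[OF _ int int meas])
    fix A assume A: "A \<in> sets (?F m)"
    from mn show "(LINT \<omega>:A|M. ?Y n \<omega>) = (LINT \<omega>:A|M. ?Y m \<omega>)"
    proof (induction n rule: dec_induct)
      case (step k)
      have "A \<in> sets (?F k)" using A sets_walk_filtration_mono[of "enat m" "enat k"] step.hyps by auto
      then show ?case using \<open>\<And>n A. A \<in> sets (?F n) \<Longrightarrow> _\<close> step.IH by simp
    qed simp
  qed
qed

lemma exists_law_pmf:
  assumes X: "X \<in> M \<rightarrow>\<^sub>M count_space (UNIV :: int set)"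
  obtains \<mu> where "measure_pmf \<mu> = distr M (count_space UNIV) X"
proof -
  let ?D = "distr M (count_space UNIV) X"
  interpret D: prob_space ?D by (rule prob_space_distr[OF X])
  have "AE x in ?D. measure ?D {x} \<noteq> 0"
    by (subst D.AE_support_countable) (auto intro: exI[of _ UNIV])
  then have "?D \<in> {M. prob_space M \<and> sets M = UNIV \<and> (AE x in M. measure M {x} \<noteq> 0)}"
    using D.prob_space_axioms by simp
  from Abs_pmf_inverse[OF this] show ?thesis by (rule that)
qed

text \<open>Shared by both directions: \<open>st\<close> says that inside the strip
  \<open>\<tau>\<close> is the first entry into \<open>D\<close>. Stopping events of different times
  are disjoint, since the longer word would have a proper prefix in \<open>D\<close>, so their
  probabilities add up to the series \<open>stop_vec\<close>.\<close>

lemma law_stop_vec: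
  assumes \<tau>: "stopping_time (walk_filtration M \<xi>) \<tau>" and fin: "AE \<omega> in M. \<tau> \<omega> < \<infinity>"
    and law: "distr M (count_space UNIV) (\<lambda>\<omega>. walk \<xi> (the_enat (\<tau> \<omega>)) \<omega>) = measure_pmf \<mu>"
    and st: "AE \<omega> in M. \<forall>n. (\<tau> \<omega> = enat n \<and> \<bar>walk \<xi> n \<omega>\<bar> \<le> int N)
      \<longleftrightarrow> \<bar>walk \<xi> n \<omega>\<bar> \<le> int N \<and> steps \<xi> n \<omega> \<in> stopped N D n (walk \<xi> n \<omega>)"
  shows "coords N \<mu> = stop_vec N D"
proof
  fix i
  show "coords N \<mu> i = stop_vec N D i"
  proof (cases "\<bar>i\<bar> \<le> int N")
    case True
    let ?X = "\<lambda>\<omega>. walk \<xi> (the_enat (\<tau> \<omega>)) \<omega>"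
    let ?A = "\<lambda>n. {\<omega> \<in> space M. steps \<xi> n \<omega> \<in> stopped N D n i}"
    note [measurable] = measurable_walk_at_stopping_time[OF \<tau>]
    have sw: "stopped N D n i \<subseteq> path_words n" for n
      by (auto simp: stopped_def arriving_def inside_words_def)
    have no: False if "steps \<xi> m \<omega> \<in> stopped N D m i" "steps \<xi> n \<omega> \<in> stopped N D n i" "m < n" for m n \<omega>
    proof -
      have "take m (steps \<xi> n \<omega>) \<notin> D" using that by (auto simp: stopped_def arriving_def)
      then show False using that by (simp add: take_steps stopped_def)
    qed
    have "disjoint_family ?A"
      unfolding disjoint_family_on_def
    proof (intro ballI impI)
      fix m n :: nat assume "m \<noteq> n"
      then show "?A m \<inter> ?A n = {}" using no[of m _ n] no[of n _ m] by (cases "m < n") auto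
    qed
    then have "(\<lambda>n. prob (?A n)) sums prob (\<Union>n. ?A n)"
      by (intro finite_measure_UNION) auto
    then have "prob (\<Union>n. ?A n) = stop_vec N D i"
      using stopped_sums[OF True, of D] unfolding prob_steps_in[OF sw] by (rule sums_unique2)
    moreover have "prob (\<Union>n. ?A n) = prob {\<omega> \<in> space M. ?X \<omega> = i}"
    proof (rule finite_measure_eq_AE)
      show "AE \<omega> in M. \<omega> \<in> (\<Union>n. ?A n) \<longleftrightarrow> \<omega> \<in> {\<omega> \<in> space M. ?X \<omega> = i}"
        using fin st AE_space
      proof eventually_elim
        case (elim \<omega>)
        then obtain k where k: "\<tau> \<omega> = enat k" by auto
        have walk_i: "walk \<xi> n \<omega> = i" if "steps \<xi> n \<omega> \<in> stopped N D n i" for n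
          using that by (auto simp: stopped_def arriving_def sum_list_steps)
        show ?case
        proof
          assume "\<omega> \<in> (\<Union>n. ?A n)"
          then obtain n where n: "steps \<xi> n \<omega> \<in> stopped N D n i" by auto
          then have "\<tau> \<omega> = enat n" using elim(2) walk_i[OF n] True by blast
          then show "\<omega> \<in> {\<omega> \<in> space M. ?X \<omega> = i}" using walk_i[OF n] elim(3) by simp
        next
          assume "\<omega> \<in> {\<omega> \<in> space M. ?X \<omega> = i}"
          then have "walk \<xi> k \<omega> = i" by (simp add: k)
          then have "steps \<xi> k \<omega> \<in> stopped N D k i" using elim(2) k True by blast
          then show "\<omega> \<in> (\<Union>n. ?A n)" using elim(3) by blast
        qed
      qed
    qed (auto intro!: sets.countable_UN')
    moreover have "pmf \<mu> i = prob {\<omega> \<in> space M. ?X \<omega> = i}"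
      by (subst pmf.rep_eq, subst law[symmetric], subst measure_distr)
        (auto simp: vimage_def Int_def conj_commute)
    ultimately show ?thesis using True by (auto simp: coords_def)
  next
    case False
    then show ?thesis by (auto simp: coords_def stop_vec_def)
  qed
qed

lemma prob_inside_words_tendsto_0:
  "(\<lambda>n. prob {\<omega> \<in> space M. steps \<xi> n \<omega> \<in> inside_words N n}) \<longlonglongrightarrow> 0"
proof -
  have "inside_words N n \<subseteq> path_words n" for n by (auto simp: inside_words_def)
  then show ?thesis
    using summable_LIMSEQ_zero[OF summable_card_inside_words[of N]] by (simp add: prob_steps_in)
qed

lemma pred_walk_inside [measurable]: "Measurable.pred M (\<lambda>\<omega>. \<bar>walk \<xi> n \<omega>\<bar> \<le> int N)"
  by (rule measurable_compose[OF measurable_walk]) simp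

text \<open>Staying inside forever means staying for every number of steps, and those probabilities
  tend to 0 as terms of a convergent series.\<close>

lemma AE_exits: "AE \<omega> in M. \<exists>n. \<bar>walk \<xi> n \<omega>\<bar> > int N"
proof -
  have "prob {\<omega> \<in> space M. \<forall>n. \<bar>walk \<xi> n \<omega>\<bar> \<le> int N} \<le> prob {\<omega> \<in> space M. steps \<xi> n \<omega> \<in> inside_words N n}" for n
  proof -
    have "AE \<omega> in M. (\<forall>n. \<bar>walk \<xi> n \<omega>\<bar> \<le> int N) \<longrightarrow> steps \<xi> n \<omega> \<in> inside_words N n"
      using AE_steps_path_words
      by eventually_elim (auto simp: inside_words_def take_steps sum_list_steps)
    then show ?thesis by (intro finite_measure_mono_AE) auto
  qed
  then have "prob {\<omega> \<in> space M. \<forall>n. \<bar>walk \<xi> n \<omega>\<bar> \<le> int N} \<le> 0"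
    by (intro LIMSEQ_le_const[OF prob_inside_words_tendsto_0]) auto
  then have "prob {\<omega> \<in> space M. \<forall>n. \<bar>walk \<xi> n \<omega>\<bar> \<le> int N} = 0"
    using measure_nonneg by (meson order_antisym)
  then have "AE \<omega> in M. \<not> (\<forall>n. \<bar>walk \<xi> n \<omega>\<bar> \<le> int N)"
    by (subst (asm) prob_Collect_eq_0) measurable
  then show ?thesis by eventually_elim (simp add: not_le)
qed

lemma UI_embeds_stop_vec:
  obtains \<tau> \<mu> where "UI_embeds M \<xi> \<tau> \<mu>" "set_pmf \<mu> \<subseteq> {-(int N + 1)..int N + 1}"
    "coords N \<mu> = stop_vec N D"
    "\<And>s. D \<inter> return_branch s = {} \<Longrightarrow> AE \<omega> in M. \<xi> 1 \<omega> = s \<and> \<xi> 2 \<omega> = - s \<longrightarrow>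
       \<bar>walk \<xi> (the_enat (\<tau> \<omega>)) \<omega>\<bar> = int N + 1"
proof -
  \<comment> \<open>Adding the words that have left the strip stops the walk at the latest on
    reaching \<plusminus>(N+1). The stopped walk is then bounded by N+1, hence uniformly
    integrable.\<close>
  define E where "E = D \<union> {w. \<bar>sum_list w\<bar> > int N}"
  define \<tau> where "\<tau> = hitting \<xi> E"
  have \<tau>: "stopping_time (walk_filtration M \<xi>) \<tau>" unfolding \<tau>_def by (rule stopping_time_hitting)
  let ?X = "\<lambda>\<omega>. walk \<xi> (the_enat (\<tau> \<omega>)) \<omega>"
  note [measurable] = measurable_walk_at_stopping_time[OF \<tau>]
  obtain \<mu> where \<mu>: "measure_pmf \<mu> = distr M (count_space UNIV) ?X"
    by (rule exists_law_pmf[of ?X]) measurable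
  have notE: "\<bar>walk \<xi> n \<omega>\<bar> \<le> int N" if "steps \<xi> n \<omega> \<notin> E" for n \<omega>
    using that by (auto simp: E_def sum_list_steps)
  have fin: "AE \<omega> in M. \<tau> \<omega> < \<infinity>"
    using AE_exits[of N]
  proof eventually_elim
    case (elim \<omega>)
    then have "\<exists>n. steps \<xi> n \<omega> \<in> E" by (auto simp: E_def sum_list_steps)
    then show ?case by (auto simp: \<tau>_def hitting_def)
  qed
  have bd: "\<bar>walk \<xi> n \<omega>\<bar> \<le> int N + 1"
    if "\<And>m. m < n \<Longrightarrow> steps \<xi> m \<omega> \<notin> E" "\<And>n. steps \<xi> n \<omega> \<in> path_words n" for n \<omega>
  proof (cases n)
    case 0
    then show ?thesis by (simp add: walk_def)
  next
    case (Suc m)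
    have "\<xi> (Suc m) \<omega> \<in> {-1, 1}" using that(2)[of "Suc m"] by (simp add: steps_Suc path_words_def)
    moreover have "\<bar>walk \<xi> m \<omega>\<bar> \<le> int N" using notE that(1) Suc by simp
    ultimately show ?thesis by (auto simp: Suc walk_Suc)
  qed
  have bX: "AE \<omega> in M. \<bar>?X \<omega>\<bar> \<le> int N + 1"
    using AE_steps_path_words fin
  proof eventually_elim
    case (elim \<omega>)
    then obtain n where n: "\<tau> \<omega> = enat n" by auto
    then have "\<forall>m<n. steps \<xi> m \<omega> \<notin> E" by (simp add: \<tau>_def hitting_eq_iff)
    then show ?case using bd[of n \<omega>] elim(1) n by simp
  qed
  have bY: "AE \<omega> in M. \<bar>stopped_walk \<xi> \<tau> n \<omega>\<bar> \<le> real N + 1" for n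
    using AE_steps_path_words
  proof eventually_elim
    case (elim \<omega>)
    have "min (enat n) (\<tau> \<omega>) \<noteq> \<infinity>" by (cases "\<tau> \<omega>") (simp_all add: min_def)
    then obtain m where m: "min (enat n) (\<tau> \<omega>) = enat m" by (cases "min (enat n) (\<tau> \<omega>)") auto
    have "steps \<xi> l \<omega> \<notin> E" if "l < m" for l
    proof
      assume "steps \<xi> l \<omega> \<in> E"
      then have "\<tau> \<omega> \<le> enat l" by (auto simp: \<tau>_def hitting_le_iff)
      also have "enat l < enat m" using that by simp
      also have "\<dots> \<le> \<tau> \<omega>" by (simp flip: m)
      finally show False by simp
    qed
    then have "\<bar>walk \<xi> m \<omega>\<bar> \<le> int N + 1" using bd elim by blast
    then have "real_of_int \<bar>walk \<xi> m \<omega>\<bar> \<le> real_of_int (int N + 1)" by (simp only: of_int_le_iff)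
    then show ?case by (simp add: stopped_walk_def m)
  qed
  have mart: "martingale M (\<lambda>n. walk_filtration M \<xi> (enat n)) (stopped_walk \<xi> \<tau>)"
    unfolding \<tau>_def by (rule martingale_stopped_hitting)
  have "uniformly_integrable M (stopped_walk \<xi> \<tau>)"
    unfolding uniformly_integrable_def
  proof (intro conjI allI impI)
    show "integrable M (stopped_walk \<xi> \<tau> n)" for n using mart by (simp add: martingale_def)
    fix \<epsilon> :: real assume "\<epsilon> > 0"
    have "(\<integral>\<omega>. \<bar>stopped_walk \<xi> \<tau> n \<omega>\<bar> * indicator {\<omega>. \<bar>stopped_walk \<xi> \<tau> n \<omega>\<bar> > real N + 1} \<omega> \<partial>M) = 0" for n
    proof (rule integral_eq_zero_AE)
      show "AE \<omega> in M. \<bar>stopped_walk \<xi> \<tau> n \<omega>\<bar> * indicator {\<omega>. \<bar>stopped_walk \<xi> \<tau> n \<omega>\<bar> > real N + 1} \<omega> = 0"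
        using bY[of n] by eventually_elim simp
    qed
    then show "\<exists>K. \<forall>n. (\<integral>\<omega>. \<bar>stopped_walk \<xi> \<tau> n \<omega>\<bar> * indicator {\<omega>. \<bar>stopped_walk \<xi> \<tau> n \<omega>\<bar> > K} \<omega> \<partial>M) \<le> \<epsilon>"
      using \<open>\<epsilon> > 0\<close> by (intro exI[of _ "real N + 1"]) simp
  qed
  then have UI: "UI_embeds M \<xi> \<tau> \<mu>"
    unfolding UI_embeds_def using \<tau> fin \<mu> mart by simp
  have "AE i in measure_pmf \<mu>. \<bar>i\<bar> \<le> int N + 1"
    unfolding \<mu> by (subst AE_distr_iff) (use bX in auto)
  then have supp: "set_pmf \<mu> \<subseteq> {-(int N + 1)..int N + 1}"
    by (auto simp: AE_measure_pmf_iff abs_le_iff)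
  have st: "AE \<omega> in M. \<forall>n. (\<tau> \<omega> = enat n \<and> \<bar>walk \<xi> n \<omega>\<bar> \<le> int N)
      \<longleftrightarrow> \<bar>walk \<xi> n \<omega>\<bar> \<le> int N \<and> steps \<xi> n \<omega> \<in> stopped N D n (walk \<xi> n \<omega>)"
    using AE_steps_path_words
  proof eventually_elim
    case (elim \<omega>)
    then show ?case
      by (auto simp: \<tau>_def hitting_eq_iff stopped_def arriving_def inside_words_def E_def
          take_steps sum_list_steps not_less)
  qed
  have coords: "coords N \<mu> = stop_vec N D"
    by (rule law_stop_vec[OF \<tau> fin \<mu>[symmetric] st])
  have "AE \<omega> in M. \<xi> 1 \<omega> = s \<and> \<xi> 2 \<omega> = - s \<longrightarrow> \<bar>?X \<omega>\<bar> = int N + 1"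
    if D: "D \<inter> return_branch s = {}" for s
    using fin bX
  proof eventually_elim
    case (elim \<omega>)
    then obtain n where n: "\<tau> \<omega> = enat n" by auto
    show ?case
    proof
      assume s: "\<xi> 1 \<omega> = s \<and> \<xi> 2 \<omega> = - s"
      have "steps \<xi> 2 \<omega> = [s, -s]" using s by (simp add: steps_Suc steps_0 numeral_2_eq_2)
      \<comment> \<open>Every prefix of this path is comparable with \<open>[s, -s]\<close>, so
        \<open>D\<close> never stops it and only the exit from the strip can.\<close>
      then have "take 2 (steps \<xi> n \<omega>) = take n [s, -s]"
        using take_steps[of 2 n \<xi> \<omega>] take_steps[of n 2 \<xi> \<omega>] by (cases "n \<le> 2") auto
      then have "steps \<xi> n \<omega> \<notin> D" using D by (auto simp: return_branch_def)
      then have "\<bar>walk \<xi> n \<omega>\<bar> > int N"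
        using n by (auto simp: \<tau>_def hitting_eq_iff E_def sum_list_steps)
      then show "\<bar>?X \<omega>\<bar> = int N + 1" using elim(2) n by simp
    qed
  qed
  with UI supp coords show ?thesis by (rule that)
qed

end

section \<open>From embeddings to sets of words\<close>

context simple_random_walk
begin

lemma AE_walk_at_support:
  assumes e: "UI_embeds M \<xi> \<tau> \<mu>" and supp: "set_pmf \<mu> \<subseteq> {-(int N + 1)..int N + 1}"
  shows "AE \<omega> in M. \<bar>walk \<xi> (the_enat (\<tau> \<omega>)) \<omega>\<bar> \<le> int N + 1"
proof -
  have \<tau>: "stopping_time (walk_filtration M \<xi>) \<tau>"
    and law: "distr M (count_space UNIV) (\<lambda>\<omega>. walk \<xi> (the_enat (\<tau> \<omega>)) \<omega>) = measure_pmf \<mu>"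
    using e by (auto simp: UI_embeds_def)
  have "AE i in measure_pmf \<mu>. \<bar>i\<bar> \<le> int N + 1"
  proof (subst AE_measure_pmf_iff, rule ballI)
    fix i assume "i \<in> set_pmf \<mu>"
    then have "i \<in> {-(int N + 1)..int N + 1}" using supp by blast
    then show "\<bar>i\<bar> \<le> int N + 1" by auto
  qed
  then show ?thesis
    unfolding law[symmetric]
    by (subst (asm) AE_distr_iff) (auto intro: measurable_walk_at_stopping_time[OF \<tau>])
qed

text \<open>For \<open>n \<ge> m\<close> the left-hand side does not change if \<open>m\<close> is replaced by \<open>n\<close>, and then the integrands
  differ only on \<open>{\<tau> > n}\<close>, where uniform integrability controls the difference.\<close>

lemma UI_embeds_optional_stopping:
  assumes e: "UI_embeds M \<xi> \<tau> \<mu>" and supp: "set_pmf \<mu> \<subseteq> {-(int N + 1)..int N + 1}"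
    and A: "A \<in> sets (walk_filtration M \<xi> (enat m))"
  shows "(LINT \<omega>:A|M. stopped_walk \<xi> \<tau> m \<omega>) = (LINT \<omega>:A|M. real_of_int (walk \<xi> (the_enat (\<tau> \<omega>)) \<omega>))"
    (is "?l = ?r")
proof -
  let ?Y = "stopped_walk \<xi> \<tau>" and ?F = "\<lambda>n. walk_filtration M \<xi> (enat n)"
  let ?X = "\<lambda>\<omega>. real_of_int (walk \<xi> (the_enat (\<tau> \<omega>)) \<omega>)"
  have \<tau>: "stopping_time (walk_filtration M \<xi>) \<tau>" and fin: "AE \<omega> in M. \<tau> \<omega> < \<infinity>"
    and mart: "martingale M ?F ?Y" and ui: "uniformly_integrable M ?Y"
    using e by (auto simp: UI_embeds_def)
  note [measurable] = measurable_walk_at_stopping_time[OF \<tau>] measurable_stopping_time_countable[OF \<tau>]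
  have int: "integrable M (?Y n)" for n using mart by (simp add: martingale_def)
  have AM: "A \<in> sets M" using A sets_walk_filtration_subset by blast
  have bX: "AE \<omega> in M. \<bar>?X \<omega>\<bar> \<le> real N + 1"
    using AE_walk_at_support[OF e supp]
  proof eventually_elim
    case (elim \<omega>)
    then have "real_of_int \<bar>walk \<xi> (the_enat (\<tau> \<omega>)) \<omega>\<bar> \<le> real_of_int (int N + 1)" by (simp only: of_int_le_iff)
    then show ?case by simp
  qed
  have Xmeas: "?X \<in> borel_measurable M"
    by (rule measurable_compose[OF measurable_walk_at_stopping_time[OF \<tau>]]) simp
  then have intX: "integrable M ?X"
    using bX by (intro integrable_const_bound[where B = "real N + 1"]) auto
  have mono: "(LINT \<omega>:A|M. ?Y n \<omega>) = ?l" if "n \<ge> m" for n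
  proof -
    interpret F: finite_measure_subalgebra M "?F m"
      by unfold_locales (rule subalgebra_walk_filtration)
    have "AE \<omega> in M. real_cond_exp M (?F m) (?Y n) \<omega> = ?Y m \<omega>"
      using mart that by (auto simp: martingale_def)
    moreover have "(LINT \<omega>:A|M. ?Y n \<omega>) = (LINT \<omega>:A|M. real_cond_exp M (?F m) (?Y n) \<omega>)"
      by (rule F.real_cond_exp_intA[OF int A])
    ultimately show ?thesis
      using AM int by (auto intro!: set_lebesgue_integral_cong_AE borel_measurable_integrable)
  qed
  have tail: "(\<lambda>n. prob {\<omega> \<in> space M. \<tau> \<omega> > enat n}) \<longlonglongrightarrow> 0"
  proof -
    have meas: "{\<omega> \<in> space M. \<tau> \<omega> > enat n} \<in> sets M" for n by measurable
    have "(\<lambda>n. prob {\<omega> \<in> space M. \<tau> \<omega> > enat n}) \<longlonglongrightarrow> prob (\<Inter>n. {\<omega> \<in> space M. \<tau> \<omega> > enat n})"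
      using meas by (intro finite_Lim_measure_decseq) (auto simp: decseq_def, metis enat_ord_simps(1) le_less_trans)
    moreover have "prob (\<Inter>n. {\<omega> \<in> space M. \<tau> \<omega> > enat n}) = prob {}"
    proof (rule finite_measure_eq_AE)
      show "AE \<omega> in M. \<omega> \<in> (\<Inter>n. {\<omega> \<in> space M. \<tau> \<omega> > enat n}) \<longleftrightarrow> \<omega> \<in> {}"
        using fin by eventually_elim auto
      show "(\<Inter>n. {\<omega> \<in> space M. \<tau> \<omega> > enat n}) \<in> sets M" using meas by blast
    qed simp
    ultimately show ?thesis by simp
  qed
  have "\<bar>?l - ?r\<bar> \<le> \<epsilon>" if "\<epsilon> > 0" for \<epsilon> :: real
  proof -
    obtain K where K: "\<And>n. (\<integral>\<omega>. \<bar>?Y n \<omega>\<bar> * indicator {\<omega>. \<bar>?Y n \<omega>\<bar> > K} \<omega> \<partial>M) \<le> \<epsilon>"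
      using ui \<open>\<epsilon> > 0\<close> unfolding uniformly_integrable_def by blast
    \<comment> \<open>On \<open>{\<tau> > n}\<close> the stopped walk is at most its part above
      \<open>K\<close> plus \<open>\<bar>K\<bar>\<close>, and the final position is at most
      N+1.\<close>
    define C where "C = \<bar>K\<bar> + real N + 1"
    let ?T = "\<lambda>n. {\<omega> \<in> space M. \<tau> \<omega> > enat n}"
    let ?U = "\<lambda>n \<omega>. \<bar>?Y n \<omega>\<bar> * indicator {\<omega>. \<bar>?Y n \<omega>\<bar> > K} \<omega>"
    have "\<bar>?l - ?r\<bar> \<le> \<epsilon> + C * prob (?T n)" if "n \<ge> m" for n
    proof -
      have intU: "integrable M (?U n)"
      proof (rule Bochner_Integration.integrable_bound[OF int[of n]])
        have [measurable]: "?Y n \<in> borel_measurable M" using int by simp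
        show "?U n \<in> borel_measurable M" by measurable
      qed (auto simp: indicator_def)
      have intT: "integrable M (\<lambda>\<omega>. C * indicator (?T n) \<omega>)"
        by (intro integrable_mult_right integrable_real_indicator) (auto simp: emeasure_eq_measure)
      have "?l - ?r = (LINT \<omega>:A|M. ?Y n \<omega> - ?X \<omega>)"
        unfolding mono[OF that, symmetric] using int intX AM
        by (intro set_integral_diff(2)[symmetric]) (auto simp: set_integrable_def intro!: integrable_mult_indicator[where 'b = real, simplified])
      also have "\<bar>\<dots>\<bar> \<le> (\<integral>\<omega>. \<bar>indicator A \<omega> * (?Y n \<omega> - ?X \<omega>)\<bar> \<partial>M)"
        unfolding set_lebesgue_integral_def real_scaleR_def by (rule integral_abs_bound)
      also have "\<dots> \<le> (\<integral>\<omega>. ?U n \<omega> + C * indicator (?T n) \<omega> \<partial>M)"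
      proof (rule integral_mono_AE)
        show "integrable M (\<lambda>\<omega>. \<bar>indicator A \<omega> * (?Y n \<omega> - ?X \<omega>)\<bar>)"
          using int intX AM
          by (intro integrable_abs integrable_mult_indicator[where 'b = real, simplified] Bochner_Integration.integrable_diff)
        show "AE \<omega> in M. \<bar>indicator A \<omega> * (?Y n \<omega> - ?X \<omega>)\<bar> \<le> ?U n \<omega> + C * indicator (?T n) \<omega>"
          using bX AE_space
        proof eventually_elim
          case (elim \<omega>)
          show ?case
          proof (cases "\<tau> \<omega> > enat n")
            case True
            have "\<bar>indicator A \<omega> * (?Y n \<omega> - ?X \<omega>)\<bar> \<le> \<bar>?Y n \<omega> - ?X \<omega>\<bar>"
              by (simp add: indicator_def)
            also have "\<dots> \<le> \<bar>?Y n \<omega>\<bar> + (real N + 1)" using elim(1) by linarith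
            also have "\<dots> \<le> ?U n \<omega> + C" by (auto simp: indicator_def C_def)
            finally show ?thesis using True elim(2) by simp
          next
            case False
            then obtain k where k: "\<tau> \<omega> = enat k" "k \<le> n" by (cases "\<tau> \<omega>") auto
            then have "?Y n \<omega> = ?X \<omega>" by (simp add: stopped_walk_def min_def)
            then show ?thesis by (simp add: C_def)
          qed
        qed
      qed (use intU intT in simp)
      also have "\<dots> = (\<integral>\<omega>. ?U n \<omega> \<partial>M) + C * prob (?T n)"
        by (subst Bochner_Integration.integral_add[OF intU intT]) (simp add: Int_def conj_commute)
      also have "\<dots> \<le> \<epsilon> + C * prob (?T n)" using K by simp
      finally show ?thesis .
    qed
    moreover have "(\<lambda>n. \<epsilon> + C * prob (?T n)) \<longlonglongrightarrow> \<epsilon> + C * 0"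
      by (intro tendsto_intros tail)
    ultimately have "\<bar>?l - ?r\<bar> \<le> \<epsilon> + C * 0" by (intro LIMSEQ_le_const) blast+
    then show ?thesis by simp
  qed
  then have "\<bar>?l - ?r\<bar> \<le> 0" by (meson field_le_epsilon add_0 dense_ge)
  then show ?thesis by simp
qed

text \<open>Optional stopping at time 0 on the whole space. The mean serves to recover the two
  masses at \<plusminus>(N+1), which the coordinates omit.\<close>

lemma UI_embeds_centered:
  assumes e: "UI_embeds M \<xi> \<tau> \<mu>" and supp: "set_pmf \<mu> \<subseteq> {-(int N + 1)..int N + 1}"
  shows "measure_pmf.expectation \<mu> real_of_int = 0"
proof -
  have \<tau>: "stopping_time (walk_filtration M \<xi>) \<tau>"
    and law: "distr M (count_space UNIV) (\<lambda>\<omega>. walk \<xi> (the_enat (\<tau> \<omega>)) \<omega>) = measure_pmf \<mu>"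
    using e by (auto simp: UI_embeds_def)
  have "measure_pmf.expectation \<mu> real_of_int = (\<integral>\<omega>. real_of_int (walk \<xi> (the_enat (\<tau> \<omega>)) \<omega>) \<partial>M)"
    unfolding law[symmetric]
    by (subst integral_distr[OF measurable_walk_at_stopping_time[OF \<tau>]]) simp_all
  also have "\<dots> = (LINT \<omega>:space M|M. real_of_int (walk \<xi> (the_enat (\<tau> \<omega>)) \<omega>))"
    by (simp add: set_lebesgue_integral_def indicator_def cong: Bochner_Integration.integral_cong)
  also have "\<dots> = (LINT \<omega>:space M|M. stopped_walk \<xi> \<tau> 0 \<omega>)"
  proof (rule UI_embeds_optional_stopping[OF e supp, symmetric])
    show "space M \<in> sets (walk_filtration M \<xi> (enat 0))"
      using sets.top[of "walk_filtration M \<xi> (enat 0)"] by simp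
  qed
  also have "\<dots> = 0" by (simp add: stopped_walk_0)
  finally show ?thesis .
qed

lemma stopping_time_determined:
  assumes \<tau>: "stopping_time (walk_filtration M \<xi>) \<tau>"
    and "\<omega> \<in> space M" "\<omega>' \<in> space M" "steps \<xi> n \<omega> = steps \<xi> n \<omega>'" "m \<le> n"
  shows "\<tau> \<omega> \<le> enat m \<longleftrightarrow> \<tau> \<omega>' \<le> enat m"
proof -
  have "steps \<xi> m \<omega> = steps \<xi> m \<omega>'"
    using assms(4,5) take_steps[of m n \<xi> \<omega>] take_steps[of m n \<xi> \<omega>'] by simp
  then show ?thesis
    using walk_filtration_determined[OF stopping_time_le_sets[OF \<tau>, of "enat m"]] assms(2,3) by blast
qed

lemma stopped_walk_determined:
  assumes \<tau>: "stopping_time (walk_filtration M \<xi>) \<tau>"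
    and "\<omega> \<in> space M" "\<omega>' \<in> space M" "steps \<xi> n \<omega> = steps \<xi> n \<omega>'" "m \<le> n"
  shows "stopped_walk \<xi> \<tau> m \<omega> = stopped_walk \<xi> \<tau> m \<omega>'"
  using assms(5)
proof (induction m)
  case (Suc m)
  have "\<xi> (Suc m) \<omega> = \<xi> (Suc m) \<omega>'"
    using nth_steps[of m n \<xi> \<omega>] nth_steps[of m n \<xi> \<omega>'] assms(4) Suc.prems by simp
  then show ?case
    using Suc stopping_time_determined[OF assms(1-4), of m] by (simp add: stopped_walk_Suc)
qed (simp add: stopped_walk_0)

text \<open>The cylinder of the word is an event of time \<open>n\<close>, so optional stopping
  identifies the constant value of the stopped walk on it with the average of the final position,
  and averages inherit the bound.\<close>

lemma stopped_walk_bounded: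
  assumes e: "UI_embeds M \<xi> \<tau> \<mu>" and supp: "set_pmf \<mu> \<subseteq> {-(int N + 1)..int N + 1}"
    and \<omega>: "\<omega> \<in> space M" "steps \<xi> n \<omega> \<in> path_words n"
  shows "\<bar>stopped_walk \<xi> \<tau> n \<omega>\<bar> \<le> real N + 1"
proof -
  have \<tau>: "stopping_time (walk_filtration M \<xi>) \<tau>" using e by (simp add: UI_embeds_def)
  let ?X = "\<lambda>\<omega>. real_of_int (walk \<xi> (the_enat (\<tau> \<omega>)) \<omega>)"
  define A where "A = {\<omega>' \<in> space M. steps \<xi> n \<omega>' = steps \<xi> n \<omega>}"
  have A: "A \<in> sets (walk_filtration M \<xi> (enat n))"
    using steps_event_in_walk_filtration[of n n "{steps \<xi> n \<omega>}"] by (simp add: A_def)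
  then have AM: "A \<in> sets M" using sets_walk_filtration_subset by blast
  have pA: "prob A = 1 / 2 ^ n" unfolding A_def by (rule prob_steps_eq[OF \<omega>(2)])
  have "(LINT \<omega>':A|M. stopped_walk \<xi> \<tau> n \<omega>') = (LINT \<omega>':A|M. stopped_walk \<xi> \<tau> n \<omega>)"
    using AM stopped_walk_determined[OF \<tau> _ \<omega>(1), of _ n n]
    by (intro set_lebesgue_integral_cong) (auto simp: A_def)
  also have "\<dots> = stopped_walk \<xi> \<tau> n \<omega> * prob A"
    using AM sets.sets_into_space[OF AM] by (simp add: set_lebesgue_integral_def Int_absorb2)
  finally have "\<bar>stopped_walk \<xi> \<tau> n \<omega>\<bar> * prob A = \<bar>LINT \<omega>':A|M. ?X \<omega>'\<bar>"
    using UI_embeds_optional_stopping[OF e supp A] by (simp add: abs_mult)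
  also have "\<dots> \<le> (\<integral>\<omega>'. \<bar>indicator A \<omega>' * ?X \<omega>'\<bar> \<partial>M)"
    unfolding set_lebesgue_integral_def real_scaleR_def by (rule integral_abs_bound)
  also have "\<dots> \<le> (\<integral>\<omega>'. (real N + 1) * indicator A \<omega>' \<partial>M)"
  proof (rule integral_mono_AE')
    show "integrable M (\<lambda>\<omega>'. (real N + 1) * indicator A \<omega>')"
      using AM by (intro integrable_mult_right integrable_real_indicator) (auto simp: emeasure_eq_measure)
    show "AE \<omega>' in M. \<bar>indicator A \<omega>' * ?X \<omega>'\<bar> \<le> (real N + 1) * indicator A \<omega>'"
      using AE_walk_at_support[OF e supp]
    proof eventually_elim
      case (elim \<omega>')
      then have "real_of_int \<bar>walk \<xi> (the_enat (\<tau> \<omega>')) \<omega>'\<bar> \<le> real_of_int (int N + 1)" by (simp only: of_int_le_iff)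
      then show ?case by (simp add: indicator_def)
    qed
  qed (simp add: indicator_def)
  also have "\<dots> = (real N + 1) * prob A"
    using sets.sets_into_space[OF AM] by (simp add: Int_absorb2)
  finally show ?thesis by (rule mult_right_le_imp_le) (simp add: pA)
qed

text \<open>A path which is not yet stopped at \<open>\<plusminus>(N+1)\<close> could step to \<open>\<plusminus>(N+2)\<close>, contradicting the previous bound.\<close>

lemma walk_inside_before_stopping:
  assumes e: "UI_embeds M \<xi> \<tau> \<mu>" and supp: "set_pmf \<mu> \<subseteq> {-(int N + 1)..int N + 1}"
    and \<omega>: "\<omega> \<in> space M" "steps \<xi> n \<omega> \<in> path_words n" and n: "enat n < \<tau> \<omega>"
  shows "\<bar>walk \<xi> n \<omega>\<bar> \<le> int N"
proof -
  have \<tau>: "stopping_time (walk_filtration M \<xi>) \<tau>" using e by (simp add: UI_embeds_def)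
  have "\<bar>walk \<xi> n \<omega> + s\<bar> \<le> int N + 1" if s: "s \<in> {-1, 1}" for s
  proof -
    have w: "steps \<xi> n \<omega> @ [s] \<in> path_words (Suc n)" using \<omega>(2) s by (auto simp: path_words_def)
    obtain \<omega>' where \<omega>': "\<omega>' \<in> space M" "steps \<xi> (Suc n) \<omega>' = steps \<xi> n \<omega> @ [s]"
      using AE_and_word[OF _ w, of "\<lambda>_. True"] by auto
    then have eq: "steps \<xi> n \<omega>' = steps \<xi> n \<omega>" by (simp add: steps_Suc)
    then have "\<not> \<tau> \<omega>' \<le> enat n"
      using stopping_time_determined[OF \<tau> \<omega>'(1) \<omega>(1) eq, of n] n by simp
    then have "enat (Suc n) \<le> \<tau> \<omega>'" by (cases "\<tau> \<omega>'") auto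
    then have "stopped_walk \<xi> \<tau> (Suc n) \<omega>' = real_of_int (walk \<xi> (Suc n) \<omega>')"
      by (simp add: stopped_walk_def min_def)
    also have "walk \<xi> (Suc n) \<omega>' = walk \<xi> n \<omega> + s"
      by (simp flip: sum_list_steps add: \<omega>'(2))
    finally have "\<bar>real_of_int (walk \<xi> n \<omega> + s)\<bar> \<le> real N + 1"
      using stopped_walk_bounded[OF e supp \<omega>'(1), of "Suc n"] \<omega>'(2) w by simp
    then have "real_of_int \<bar>walk \<xi> n \<omega> + s\<bar> \<le> real_of_int (int N + 1)" by simp
    then show ?thesis by (simp only: of_int_le_iff)
  qed
  from this[of 1] this[of "-1"] show ?thesis by auto
qed

text \<open>Whether \<open>\<tau>\<close> equals \<open>n\<close> is decided by the first
  \<open>n\<close> steps, so \<open>D\<close> does not depend on the sample point chosen for a word.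
  The second conclusion is restricted to interior sites because \<open>D\<close> also contains the
  words stopped at \<plusminus>(N+1), where a spared branch does end.\<close>

lemma UI_embeds_imp_stop_vec:
  assumes e: "UI_embeds M \<xi> \<tau> \<mu>" and supp: "set_pmf \<mu> \<subseteq> {-(int N + 1)..int N + 1}"
  obtains D where "coords N \<mu> = stop_vec N D"
    "\<And>s n i. s \<in> {-1, 1} \<Longrightarrow> (AE \<omega> in M. \<xi> 1 \<omega> = s \<and> \<xi> 2 \<omega> = - s \<longrightarrow>
       \<bar>walk \<xi> (the_enat (\<tau> \<omega>)) \<omega>\<bar> = int N + 1) \<Longrightarrow> \<bar>i\<bar> \<le> int N \<Longrightarrow>
       stopped N D n i \<inter> return_branch s = {}"
proof -
  have \<tau>: "stopping_time (walk_filtration M \<xi>) \<tau>" and fin: "AE \<omega> in M. \<tau> \<omega> < \<infinity>"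
    and law: "distr M (count_space UNIV) (\<lambda>\<omega>. walk \<xi> (the_enat (\<tau> \<omega>)) \<omega>) = measure_pmf \<mu>"
    using e by (auto simp: UI_embeds_def)
  define D where "D = {w. \<exists>\<omega>\<in>space M. steps \<xi> (length w) \<omega> = w \<and> \<tau> \<omega> = enat (length w)}"
  have eq_det: "\<tau> \<omega>' = enat n"
    if "\<tau> \<omega> = enat n" "\<omega> \<in> space M" "\<omega>' \<in> space M" "steps \<xi> n \<omega> = steps \<xi> n \<omega>'" for \<omega> \<omega>' n
  proof -
    have a: "\<tau> \<omega>' \<le> enat m \<longleftrightarrow> n \<le> m" if "m \<le> n" for m
      using stopping_time_determined[OF \<tau> \<open>\<omega> \<in> space M\<close> \<open>\<omega>' \<in> space M\<close>, of n m] that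
        \<open>\<tau> \<omega> = enat n\<close> \<open>steps \<xi> n \<omega> = steps \<xi> n \<omega>'\<close> by simp
    then obtain k where k: "\<tau> \<omega>' = enat k" "k \<le> n" using a[of n] by (cases "\<tau> \<omega>'") auto
    then show ?thesis using a[of k] by simp
  qed
  have D: "steps \<xi> n \<omega> \<in> D \<longleftrightarrow> \<tau> \<omega> = enat n" if "\<omega> \<in> space M" for n \<omega>
  proof
    assume "steps \<xi> n \<omega> \<in> D"
    then obtain \<omega>' where "\<omega>' \<in> space M" "steps \<xi> n \<omega>' = steps \<xi> n \<omega>" "\<tau> \<omega>' = enat n"
      unfolding D_def mem_Collect_eq length_steps by blast
    then show "\<tau> \<omega> = enat n" using eq_det[of \<omega>' n \<omega>] that by blast
  next
    assume "\<tau> \<omega> = enat n"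
    then show "steps \<xi> n \<omega> \<in> D" unfolding D_def mem_Collect_eq length_steps using that by blast
  qed
  have st: "AE \<omega> in M. \<forall>n. (\<tau> \<omega> = enat n \<and> \<bar>walk \<xi> n \<omega>\<bar> \<le> int N)
      \<longleftrightarrow> \<bar>walk \<xi> n \<omega>\<bar> \<le> int N \<and> steps \<xi> n \<omega> \<in> stopped N D n (walk \<xi> n \<omega>)"
    using AE_steps_path_words AE_space
  proof eventually_elim
    case (elim \<omega>)
    have "\<bar>walk \<xi> m \<omega>\<bar> \<le> int N" if "\<tau> \<omega> = enat n" "m < n" for m n
      using walk_inside_before_stopping[OF e supp elim(2)] elim(1) that by simp
    then show ?case
      using elim D[OF elim(2)]
      by (auto simp: stopped_def arriving_def inside_words_def take_steps sum_list_steps)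
  qed
  have "coords N \<mu> = stop_vec N D" by (rule law_stop_vec[OF \<tau> fin law st])
  moreover have "stopped N D n i \<inter> return_branch s = {}"
    if s: "s \<in> {-1, 1}" and spare: "AE \<omega> in M. \<xi> 1 \<omega> = s \<and> \<xi> 2 \<omega> = - s \<longrightarrow>
       \<bar>walk \<xi> (the_enat (\<tau> \<omega>)) \<omega>\<bar> = int N + 1" and i: "\<bar>i\<bar> \<le> int N" for s n i
  proof (rule equals0I)
    fix w assume w: "w \<in> stopped N D n i \<inter> return_branch s"
    then have wD: "w \<in> D" "sum_list w = i" and pw: "w \<in> path_words n"
      by (auto simp: stopped_def arriving_def inside_words_def)
    \<comment> \<open>A word of length below 2 is extended to \<open>[s, -s]\<close>, so that a
      sample path through it really takes the return and the sparing condition applies.\<close>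
    have "\<exists>u. \<exists>k\<ge>2. u \<in> path_words k \<and> take 2 u = [s, -s] \<and> take n u = w \<and> n \<le> k"
    proof (cases "n \<ge> 2")
      case True
      then show ?thesis using w pw by (intro exI[of _ w]) (auto simp: return_branch_def path_words_def)
    next
      case False
      then show ?thesis
        using w pw s by (intro exI[of _ "[s, -s]"] exI[of _ 2]) (auto simp: return_branch_def path_words_def)
    qed
    then obtain u k where u: "k \<ge> 2" "u \<in> path_words k" "take 2 u = [s, -s]" "take n u = w" "n \<le> k" by blast
    obtain \<omega> where \<omega>: "\<omega> \<in> space M" "steps \<xi> k \<omega> = u"
      "\<xi> 1 \<omega> = s \<and> \<xi> 2 \<omega> = - s \<longrightarrow> \<bar>walk \<xi> (the_enat (\<tau> \<omega>)) \<omega>\<bar> = int N + 1"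
      using AE_and_word[OF spare u(2)] by blast
    have "steps \<xi> 2 \<omega> = [s, -s]" using take_steps[OF u(1), of \<xi> \<omega>] \<omega>(2) u(3) by simp
    then have "\<xi> 1 \<omega> = s \<and> \<xi> 2 \<omega> = - s" by (simp add: steps_Suc steps_0 numeral_2_eq_2)
    moreover have "steps \<xi> n \<omega> = w" using take_steps[OF u(5), of \<xi> \<omega>] \<omega>(2) u(4) by simp
    then have "\<tau> \<omega> = enat n" "walk \<xi> n \<omega> = i"
      using D[OF \<omega>(1), of n] wD sum_list_steps[of \<xi> n \<omega>] by auto
    ultimately show False using \<omega>(3) i by simp
  qed
  ultimately show ?thesis by (rule that)
qed

section \<open>The sets \<open>S\<close> and \<open>W\<close> in terms of words\<close>

lemma S_set_eq: "S_set M \<xi> N = range (stop_vec N)"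
proof (intro equalityI subsetI)
  fix p assume "p \<in> S_set M \<xi> N"
  then obtain \<mu> \<tau> where e: "UI_embeds M \<xi> \<tau> \<mu>" "set_pmf \<mu> \<subseteq> {-(int N + 1)..int N + 1}"
    and p: "p = coords N \<mu>" by (auto simp: S_set_def M0_UI_def)
  obtain D where "coords N \<mu> = stop_vec N D" by (rule UI_embeds_imp_stop_vec[OF e])
  then show "p \<in> range (stop_vec N)" by (simp add: p)
next
  fix p assume "p \<in> range (stop_vec N)"
  then obtain D where p: "p = stop_vec N D" by auto
  obtain \<tau> \<mu> where e: "UI_embeds M \<xi> \<tau> \<mu>" "set_pmf \<mu> \<subseteq> {-(int N + 1)..int N + 1}"
    and c: "coords N \<mu> = p"
    unfolding p by (rule UI_embeds_stop_vec[of N D])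
  have "\<mu> \<in> {\<mu> \<in> M0_UI M \<xi>. set_pmf \<mu> \<subseteq> {-(int N + 1)..int N + 1}}"
    using e unfolding M0_UI_def by blast
  then show "p \<in> S_set M \<xi> N" unfolding S_set_def c[symmetric] by (rule imageI)
qed

text \<open>From left to right, \<open>stop_vec_diff\<close> removes the words of the branch, none
  of which is stopped at an interior site. From right to left, adding 1/4 at 0 amounts to stopping
  at once at the spared return.\<close>

lemma W_set_eq:
  assumes "N \<ge> 1" shows "W_set M \<xi> N = sparing_vecs N"
proof (intro equalityI subsetI)
  fix p assume "p \<in> W_set M \<xi> N"
  then obtain \<mu> \<tau> s where s: "s \<in> {-1, 1}"
    and e: "UI_embeds M \<xi> \<tau> \<mu>" "set_pmf \<mu> \<subseteq> {-(int N + 1)..int N + 1}" and p: "coords N \<mu> = p"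
    and spare: "AE \<omega> in M. \<xi> 1 \<omega> = s \<and> \<xi> 2 \<omega> = - s \<longrightarrow> \<bar>walk \<xi> (the_enat (\<tau> \<omega>)) \<omega>\<bar> = int N + 1"
    unfolding W_set_def spares_return_path_def by blast
  obtain D where D: "coords N \<mu> = stop_vec N D"
    "\<And>n i. \<bar>i\<bar> \<le> int N \<Longrightarrow> stopped N D n i \<inter> return_branch s = {}"
    by (rule UI_embeds_imp_stop_vec[OF e]) (use s spare in blast)
  then have "p = stop_vec N (D - return_branch s)" using p stop_vec_diff by metis
  then show "p \<in> sparing_vecs N" using s unfolding sparing_vecs_def by blast
next
  fix p assume p: "p \<in> sparing_vecs N"
  then obtain s D where s: "s \<in> {-1, 1}" and D: "D \<inter> return_branch s = {}" "p = stop_vec N D"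
    unfolding sparing_vecs_def by blast
  have "(\<lambda>i. p i + 1/4 * unit_vec 0 i) \<in> S_set M \<xi> N"
    using sparing_vecs_add[OF assms p unit_vec_0_in_range] by (simp add: S_set_eq add.commute)
  moreover have "spares_return_path M \<xi> N p"
  proof (rule UI_embeds_stop_vec[of N D])
    fix \<tau> \<mu>
    assume "UI_embeds M \<xi> \<tau> \<mu>" "set_pmf \<mu> \<subseteq> {-(int N + 1)..int N + 1}" "coords N \<mu> = stop_vec N D"
      and spare: "\<And>s. D \<inter> return_branch s = {} \<Longrightarrow> AE \<omega> in M. \<xi> 1 \<omega> = s \<and> \<xi> 2 \<omega> = - s \<longrightarrow>
       \<bar>walk \<xi> (the_enat (\<tau> \<omega>)) \<omega>\<bar> = int N + 1"
    then show ?thesis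
      using s spare[OF D(1)] unfolding spares_return_path_def D(2) by blast
  qed
  ultimately show "p \<in> W_set M \<xi> N" using D(2) by (auto simp: W_set_def S_set_eq)
qed

lemma S_set_bounds:
  assumes "p \<in> S_set M \<xi> N"
  shows "p i \<ge> 0" "(\<Sum>i\<in>{-int N..int N}. p i) \<le> 1" "p i \<le> 1" "i \<notin> {-int N..int N} \<Longrightarrow> p i = 0"
proof -
  obtain \<mu> where p: "p = coords N \<mu>" using assms by (auto simp: S_set_def)
  show "p i \<ge> 0" "p i \<le> 1" "i \<notin> {-int N..int N} \<Longrightarrow> p i = 0"
    by (auto simp: p coords_def pmf_le_1)
  have "(\<Sum>i\<in>{-int N..int N}. p i) = (\<Sum>i\<in>{-int N..int N}. pmf \<mu> i)"
    by (intro sum.cong) (simp_all add: p coords_def)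
  also have "\<dots> = measure_pmf.prob \<mu> {-int N..int N}" by (simp add: measure_measure_pmf_finite)
  finally show "(\<Sum>i\<in>{-int N..int N}. p i) \<le> 1" by simp
qed

text \<open>Since 1/4 can be added at 0 without exceeding total mass 1, \<open>q\<close> has total
  mass at most 3/4. This leaves room in the cube for a quarter of any of its points.\<close>

lemma W_set_le:
  assumes "q \<in> W_set M \<xi> N" shows "q i \<le> 3/4"
proof (cases "i \<in> {-int N..int N}")
  case True
  have q: "q \<in> S_set M \<xi> N" and q': "(\<lambda>i. q i + 1/4 * unit_vec 0 i) \<in> S_set M \<xi> N"
    using assms by (auto simp: W_set_def)
  have "q i \<le> (\<Sum>i\<in>{-int N..int N}. q i)"
    using True S_set_bounds(1)[OF q] by (intro member_le_sum) auto
  moreover have "(\<Sum>i\<in>{-int N..int N}. 1/4 * unit_vec 0 i) = 1/4"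
    by (simp add: unit_vec_def flip: sum_divide_distrib)
  ultimately show ?thesis
    using S_set_bounds(2)[OF q'] by (simp only: sum.distrib)
next
  case False
  then show ?thesis using assms S_set_bounds(4)[of q N i] by (simp add: W_set_def)
qed

end

text \<open>Only the masses at the two endpoints are unknown, and total mass and mean are two
  independent linear equations for them.\<close>

lemma pmf_eqI_centered:
  assumes "set_pmf \<mu> \<subseteq> {-(int N + 1)..int N + 1}" "set_pmf \<nu> \<subseteq> {-(int N + 1)..int N + 1}"
    and "measure_pmf.expectation \<mu> real_of_int = 0" "measure_pmf.expectation \<nu> real_of_int = 0"
    and eq: "\<And>i. \<bar>i\<bar> \<le> int N \<Longrightarrow> pmf \<mu> i = pmf \<nu> i"
  shows "\<mu> = \<nu>"
proof -
  let ?I = "{-(int N + 1)..int N + 1}" and ?J = "{-int N..int N}"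
  define d where "d i = pmf \<mu> i - pmf \<nu> i" for i
  have I: "?I = insert (- (int N + 1)) (insert (int N + 1) ?J)" by auto
  have mass: "(\<Sum>i\<in>?I. pmf \<kappa> i) = 1" if "set_pmf \<kappa> \<subseteq> ?I" for \<kappa>
    by (rule sum_pmf_eq_1) (use that in auto)
  have expct: "measure_pmf.expectation \<kappa> real_of_int = (\<Sum>i\<in>?I. real_of_int i * pmf \<kappa> i)"
    if "set_pmf \<kappa> \<subseteq> ?I" for \<kappa>
    by (subst integral_measure_pmf[of ?I]) (use that in \<open>auto simp: mult.commute set_pmf_iff\<close>)
  have dJ: "d i = 0" if "i \<in> ?J" for i using eq that by (simp add: d_def abs_le_iff)
  have "(\<Sum>i\<in>?I. d i) = 0"
    using mass assms(1,2) by (simp add: d_def sum_subtractf)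
  then have 1: "d (- (int N + 1)) + d (int N + 1) = 0" unfolding I using dJ by simp
  have "(\<Sum>i\<in>?I. real_of_int i * d i) = 0"
    using expct[OF assms(1)] expct[OF assms(2)] assms(3,4) by (simp add: d_def sum_subtractf right_diff_distrib)
  then have "real_of_int (- (int N + 1)) * d (- (int N + 1)) + real_of_int (int N + 1) * d (int N + 1) = 0"
    unfolding I using dJ by simp
  then have "real_of_int (int N + 1) * (d (int N + 1) - d (- (int N + 1))) = 0"
    by (simp add: algebra_simps)
  then have 2: "d (int N + 1) = d (- (int N + 1))" by simp
  have "d i = 0" if "i \<in> ?I" for i
    using that 1 2 dJ unfolding I by auto
  moreover have "d i = 0" if "i \<notin> ?I" for i
  proof -
    have "i \<notin> set_pmf \<mu>" "i \<notin> set_pmf \<nu>" using that assms(1,2) by blast+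
    then show ?thesis by (simp add: d_def set_pmf_iff)
  qed
  ultimately have "pmf \<mu> i = pmf \<nu> i" for i unfolding d_def by (metis eq_iff_diff_eq_0)
  then show ?thesis by (rule pmf_eqI)
qed

theorem theorem7:
  fixes M :: "'a measure" and \<xi> :: "nat \<Rightarrow> 'a \<Rightarrow> int" and N :: nat
  assumes "simple_random_walk M \<xi>"
    and "N > 1"
  shows "(\<forall>\<mu>\<in>M0. set_pmf \<mu> \<subseteq> {-(int N + 1)..int N + 1} \<longrightarrow>
            (\<mu> \<in> M0_UI M \<xi> \<longleftrightarrow>
              (\<exists>a k. arrival_counts N a k \<and>
                 (\<forall>i\<in>{-int N..int N}.
                    (\<lambda>j. 2 ^ nat (i mod 2) * (real (a j i) / 4 ^ j)) sums pmf \<mu> i \<and>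
                    (\<forall>n. int (a n i) \<le> k n i)))))
       \<and> closed (S_set M \<xi> N) \<and> S_set M \<xi> N \<subseteq> unit_cube N
       \<and> compact (W_set M \<xi> N)
       \<and> (\<forall>A. closed A \<and> A \<subseteq> unit_cube N \<longrightarrow>
            closed (f_map M \<xi> N A) \<and> f_map M \<xi> N A \<subseteq> unit_cube N)
       \<and> f_map M \<xi> N (S_set M \<xi> N) = S_set M \<xi> N
       \<and> (\<forall>A. closed A \<and> A \<subseteq> unit_cube N \<and> f_map M \<xi> N A = A \<longrightarrow> A = S_set M \<xi> N)"
proof -
  interpret simple_random_walk M \<xi> by fact
  have N: "N \<ge> 1" using assms(2) by simp
  have mem: "i \<in> {-int N..int N} \<longleftrightarrow> \<bar>i\<bar> \<le> int N" for i by auto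
  have iff: "\<mu> \<in> M0_UI M \<xi> \<longleftrightarrow> (\<exists>a k. arrival_counts N a k \<and>
                 (\<forall>i\<in>{-int N..int N}.
                    (\<lambda>j. 2 ^ nat (i mod 2) * (real (a j i) / 4 ^ j)) sums pmf \<mu> i \<and>
                    (\<forall>n. int (a n i) \<le> k n i)))"
    if \<mu>: "\<mu> \<in> M0" and supp: "set_pmf \<mu> \<subseteq> {-(int N + 1)..int N + 1}" for \<mu>
  proof
    assume "\<mu> \<in> M0_UI M \<xi>"
    then obtain \<tau> where "UI_embeds M \<xi> \<tau> \<mu>" by (auto simp: M0_UI_def)
    then obtain D where D: "coords N \<mu> = stop_vec N D" by (rule UI_embeds_imp_stop_vec[OF _ supp])
    obtain a k where ak: "arrival_counts N a k"
      "\<forall>i\<in>{-int N..int N}. \<forall>n. a n i = card (stopped N D (count_time n i) i) \<and> int (a n i) \<le> k n i"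
      using stopping_set_counts[of N D] by blast
    have "(\<lambda>j. 2 ^ nat (i mod 2) * (real (a j i) / 4 ^ j)) sums pmf \<mu> i" if i: "i \<in> {-int N..int N}" for i
    proof -
      have "pmf \<mu> i = stop_vec N D i" using fun_cong[OF D, of i] i by (simp add: coords_def)
      moreover have "a n i = card (stopped N D (count_time n i) i)" for n using ak(2) i by blast
      ultimately show ?thesis using stopped_count_sums[of i N D] i by (simp only: mem)
    qed
    with ak show "\<exists>a k. arrival_counts N a k \<and>
                 (\<forall>i\<in>{-int N..int N}.
                    (\<lambda>j. 2 ^ nat (i mod 2) * (real (a j i) / 4 ^ j)) sums pmf \<mu> i \<and>
                    (\<forall>n. int (a n i) \<le> k n i))" by blast
  next
    assume "\<exists>a k. arrival_counts N a k \<and>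
                 (\<forall>i\<in>{-int N..int N}.
                    (\<lambda>j. 2 ^ nat (i mod 2) * (real (a j i) / 4 ^ j)) sums pmf \<mu> i \<and>
                    (\<forall>n. int (a n i) \<le> k n i))"
    then obtain a k where ak: "arrival_counts N a k"
      "\<And>i. \<bar>i\<bar> \<le> int N \<Longrightarrow> (\<lambda>j. 2 ^ nat (i mod 2) * (real (a j i) / 4 ^ j)) sums pmf \<mu> i"
      "\<And>i n. \<bar>i\<bar> \<le> int N \<Longrightarrow> int (a n i) \<le> k n i"
      unfolding Ball_def mem by blast
    from counts_stopping_set[OF ak(1,3)] obtain D where
      D: "\<And>n i. \<bar>i\<bar> \<le> int N \<Longrightarrow> a n i = card (stopped N D (count_time n i) i)" by blast
    obtain \<tau> \<nu> where \<nu>: "UI_embeds M \<xi> \<tau> \<nu>" "set_pmf \<nu> \<subseteq> {-(int N + 1)..int N + 1}"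
      "coords N \<nu> = stop_vec N D" by (rule UI_embeds_stop_vec[of N D])
    have "\<mu> = \<nu>"
    proof (rule pmf_eqI_centered[OF supp \<nu>(2)])
      show "measure_pmf.expectation \<mu> real_of_int = 0" using \<mu> by (simp add: M0_def)
      show "measure_pmf.expectation \<nu> real_of_int = 0" by (rule UI_embeds_centered[OF \<nu>(1,2)])
      fix i assume i: "\<bar>i\<bar> \<le> int N"
      have "pmf \<mu> i = stop_vec N D i"
        using sums_unique2[OF ak(2)[OF i]] stopped_count_sums[OF i, of D] D[OF i] by simp
      also have "\<dots> = pmf \<nu> i"
        using fun_cong[OF \<nu>(3), of i] i by (simp add: coords_def abs_le_iff)
      finally show "pmf \<mu> i = pmf \<nu> i" .
    qed
    then show "\<mu> \<in> M0_UI M \<xi>" using \<nu>(1) by (auto simp: M0_UI_def)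
  qed
  have S_closed: "closed (S_set M \<xi> N)"
    unfolding S_set_eq by (rule compact_imp_closed[OF compact_range_stop_vec])
  have S_cube: "S_set M \<xi> N \<subseteq> unit_cube N"
    using S_set_bounds by (auto simp: unit_cube_def)
  have W: "compact (W_set M \<xi> N)"
    unfolding W_set_eq[OF N] by (rule compact_sparing_vecs)
  have closed_f: "closed (f_map M \<xi> N A)" if "closed A" "A \<subseteq> unit_cube N" for A
    unfolding f_map_def
    using that compact_Int_closed[OF compact_unit_cube[of N] that(1)] W
    by (intro closed_f_image) (simp_all add: Int_absorb1)
  have f_cube: "f_map M \<xi> N A \<subseteq> unit_cube N" if A: "A \<subseteq> unit_cube N" for A
  proof
    fix p assume "p \<in> f_map M \<xi> N A"
    then consider q a where "q \<in> W_set M \<xi> N" "a \<in> A" "p = (\<lambda>i. 1/4 * a i + q i)" | "p \<in> g_map A"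
      by (auto simp: f_map_def)
    then show "p \<in> unit_cube N"
    proof cases
      case 1
      have q: "q \<in> S_set M \<xi> N" using 1(1) by (simp add: W_set_def)
      have a: "a \<in> unit_cube N" using A 1(2) by blast
      show ?thesis
        unfolding unit_cube_def
      proof (intro CollectI conjI ballI allI impI)
        fix i assume "i \<in> {-int N..int N}"
        then have "a i \<in> {0..1}" using a by (auto simp: unit_cube_def)
        then show "p i \<in> {0..1}"
          using S_set_bounds(1)[OF q, of i] W_set_le[OF 1(1), of i] by (simp add: 1(3))
      next
        fix i assume "i \<notin> {-int N..int N}"
        then show "p i = 0" using a S_set_bounds(4)[OF q] by (simp add: 1(3) unit_cube_def)
      qed
    next
      case 2
      then show ?thesis using N by (auto simp: g_map_def unit_cube_def unit_vec_def)
    qed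
  qed
  have fixed_point: "f_map M \<xi> N (S_set M \<xi> N) = S_set M \<xi> N"
    using range_stop_vec_self_similar[OF N] by (simp only: f_map_def S_set_eq W_set_eq[OF N])
  have uniq: "A = S_set M \<xi> N" if A: "closed A" "A \<subseteq> unit_cube N" "f_map M \<xi> N A = A" for A
  proof
    \<comment> \<open>\<open>W\<close> does not vary with the set, so both sets satisfy the same
      equation and the inclusion applies in both orders.\<close>
    note eqA = A(3)[symmetric, unfolded f_map_def]
    note eqS = fixed_point[symmetric, unfolded f_map_def]
    show "A \<subseteq> S_set M \<xi> N" by (rule self_similar_subset[OF S_closed S_cube eqS A(2) eqA])
    show "S_set M \<xi> N \<subseteq> A" by (rule self_similar_subset[OF A(1,2) eqA S_cube eqS])
  qed
  show ?thesis 
    by (intro conjI ballI allI impI; (elim conjE)?;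
        rule iff S_closed S_cube W closed_f f_cube fixed_point uniq; assumption)
qed

end
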